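(* Let $E\in\mathbb{R}^{d\times d}$ and $D\in\mathbb{R}^{m\times m}$ be matrices all of whose eigenvalues have positive real part, let $c\in(0,1)$, and let $X=\{X(t)\}_{t\in\mathbb{R}^d}$ be a $(c^E,c^D)$-self-affine random field on $\mathbb{R}^m$ such that its occupation measure $\tau_X$ on $\mathbb{R}^d\times\mathbb{R}^m$ satisfies the b.c.i. condition with respect to $W=c^E\oplus c^D$. Let $q=\operatorname{trace}(E)$ and let $0<\lambda_1<\dots<\lambda_p$ be the distinct real parts of the eigenvalues of $D$, with multiplicities $m_1,\dots,m_p$. Then with probability one $$\dim_{\mathcal H}X([0,1]^d)\ge s(c^D,c^q),$$ where $X([0,1]^d)=\{X(t):t\in[0,1]^d\}$ and $$s(c^D,c^q)=\begin{cases}\displaystyle\frac1{\lambda_\ell}\Big(q+\sum_{i=1}^{\ell}(\lambda_\ell-\lambda_i)m_i\Big)&\text{if }\displaystyle\sum_{i=1}^{\ell-1}\lambda_im_i<q\le\sum_{i=1}^{\ell}\lambda_im_i\text{ for some }\ell\in\{1,\dots,p\},\\[2ex] m&\text{otherwise.}\end{cases}$$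
   Context: $\boldsymbol{\lambda}_n$ is Lebesgue measure on $\mathbb{R}^n$, $\dim_{\mathcal H}$ is Hausdorff dimension, $c^E=\exp(E\log c)$, and $\oplus$ denotes the block-diagonal matrix. The multiplicity $m_i$ is the number of eigenvalues of $D$ (counted with algebraic multiplicity, over $\mathbb{C}$) with real part $\lambda_i$, so $m_1+\dots+m_p=m$. For contracting (all eigenvalues of modulus $<1$) non-singular matrices $U\in\mathbb{R}^{d\times d}$, $V\in\mathbb{R}^{m\times m}$, a random field $X=\{X(t)\}_{t\in\mathbb{R}^d}$ on $\mathbb{R}^m$ (i.e. with values in $\mathbb{R}^m$), defined on a probability space $(\Omega,\mathcal A,P)$, is $(U,V)$-self-affine if: (i) $\{X(Ut)\}_{t\in\mathbb{R}^d}$ and $\{VX(t)\}_{t\in\mathbb{R}^d}$ have the same finite-dimensional distributions; (ii) $X$ has stationary increments, i.e. $X(t)-X(s)$ and $X(t-s)$ have the same distribution for all $s,t\in\mathbb{R}^d$; (iii) $X$ is proper, i.e. for every $t\neq0$ the distribution of $X(t)$ is not supported on any lower-dimensional hyperplane of $\mathbb{R}^m$; (iv) the mapping $X:\mathbb{R}^d\times\Omega\to\mathbb{R}^m$ is $(\mathcal B(\mathbb{R}^d)\otimes\mathcal A)$-$\mathcal B(\mathbb{R}^m)$-measurable. The occupation measure $\tau_X$ (of the graph) is the random Borel measure on $\mathbb{R}^d\times\mathbb{R}^m$ determined by $\tau_X(A\times B)=\boldsymbol{\lambda}_d\{t\in A: X(t)\in B\}$ for Borel $A\subset\mathbb{R}^d$,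 $B\subset\mathbb{R}^m$. Its intensity measure is $\mathbb{E}[\tau_X](A)=\mathbb{E}[\tau_X(A)]$ for Borel $A\subset\mathbb{R}^{d+m}$. It satisfies the b.c.i. (boundedly continuous intensity) condition with respect to $W$ if there is a constant $0<C<\infty$ such that $\mathbb{E}[\tau_X](A)\le C\,\boldsymbol{\lambda}_{d+m}(A)$ for every Borel set $A\subset[-1,1]^{d+m}\setminus W([-1,1]^{d+m})$. *)

theory Defs
  imports "HOL-Probability.Probability" "HOL-Computational_Algebra.Polynomial"
begin

definition cmat :: "real^'n^'n \<Rightarrow> complex^'n^'n" where
  "cmat A = map_matrix complex_of_real A"

definition ceigenvalue :: "real^'n^'n \<Rightarrow> complex \<Rightarrow> bool" where
  "ceigenvalue A z \<longleftrightarrow> (\<exists>v. v \<noteq> 0 \<and> cmat A *v v = z *s v)"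

definition charpoly :: "real^'n^'n \<Rightarrow> complex poly" where
  "charpoly A = det (mat [:0, 1:] - map_matrix (\<lambda>a. [:a:]) (cmat A))"

definition re_multiplicity :: "real^'n^'n \<Rightarrow> real \<Rightarrow> nat" where
  "re_multiplicity A r = (\<Sum>z\<in>{z. ceigenvalue A z \<and> Re z = r}. order z (charpoly A))"

definition contracting :: "real^'n^'n \<Rightarrow> bool" where
  "contracting A \<longleftrightarrow> (\<forall>z. ceigenvalue A z \<longrightarrow> cmod z < 1)"

text \<open>The multiplication that the type of vectors inherits from its components is not the
  matrix product \<open>**\<close>, so \<open>c\<^sup>E = exp (E log c)\<close> needs its own power and exponential series.\<close>

primrec mat_pow :: "real^'n^'n \<Rightarrow> nat \<Rightarrow> real^'n^'n" where
  "mat_pow A 0 = mat 1"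
| "mat_pow A (Suc k) = A ** mat_pow A k"

definition mat_exp :: "real^'n^'n \<Rightarrow> real^'n^'n" where
  "mat_exp A = (\<Sum>k. mat_pow A k /\<^sub>R fact k)"

definition mat_powr :: "real \<Rightarrow> real^'n^'n \<Rightarrow> real^'n^'n" where
  "mat_powr c A = mat_exp (ln c *\<^sub>R A)"

text \<open>\<open>(diam U)\<^sup>s\<close>, with the usual conventions that \<open>0\<^sup>0 = 1\<close> and that the empty set
  contributes 0; note \<open>0 powr 0 = 0\<close>.\<close>
definition diam_pow :: "real \<Rightarrow> 'a::metric_space set \<Rightarrow> ennreal" where
  "diam_pow s U =
     (if U = {} then 0 else if s = 0 then 1 else ennreal (diameter U powr s))"

text \<open>Boundedness is required explicitly, since \<open>diameter\<close> is real-valued and hence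
  meaningless for unbounded sets.\<close>
definition hausdorff_content :: "real \<Rightarrow> real \<Rightarrow> 'a::metric_space set \<Rightarrow> ennreal" where
  "hausdorff_content s \<delta> A =
     (INF U \<in> {U :: nat \<Rightarrow> 'a set. A \<subseteq> (\<Union>i. U i) \<and> (\<forall>i. bounded (U i) \<and> diameter (U i) \<le> \<delta>)}.
        \<Sum>i. diam_pow s (U i))"

definition hausdorff_measure :: "real \<Rightarrow> 'a::metric_space set \<Rightarrow> ennreal" where
  "hausdorff_measure s A = (SUP \<delta>\<in>{0<..}. hausdorff_content s \<delta> A)"

definition hausdorff_dim :: "'a::metric_space set \<Rightarrow> ereal" where
  "hausdorff_dim A = Inf (ereal ` {s. 0 \<le> s \<and> hausdorff_measure s A = 0})"

definition same_fdd ::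
  "'w measure \<Rightarrow> ('i \<Rightarrow> 'w \<Rightarrow> 'b::topological_space) \<Rightarrow> ('i \<Rightarrow> 'w \<Rightarrow> 'b) \<Rightarrow> bool" where
  "same_fdd M X Y \<longleftrightarrow>
     (\<forall>J. finite J \<longrightarrow>
        distr M (\<Pi>\<^sub>M t\<in>J. borel) (\<lambda>\<omega>. \<lambda>t\<in>J. X t \<omega>) =
        distr M (\<Pi>\<^sub>M t\<in>J. borel) (\<lambda>\<omega>. \<lambda>t\<in>J. Y t \<omega>))"

definition stationary_increments ::
  "'w measure \<Rightarrow> (real^'d \<Rightarrow> 'w \<Rightarrow> real^'m) \<Rightarrow> bool" where
  "stationary_increments M X \<longleftrightarrow>
     (\<forall>s t. distr M borel (\<lambda>\<omega>. X t \<omega> - X s \<omega>) = distr M borel (X (t - s)))"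

definition proper_field :: "'w measure \<Rightarrow> (real^'d \<Rightarrow> 'w \<Rightarrow> real^'m) \<Rightarrow> bool" where
  "proper_field M X \<longleftrightarrow>
     (\<forall>t. t \<noteq> 0 \<longrightarrow>
        (\<forall>H. affine H \<and> aff_dim H < int CARD('m) \<longrightarrow> \<not> (AE \<omega> in M. X t \<omega> \<in> H)))"

definition self_affine ::
  "'w measure \<Rightarrow> real^'d^'d \<Rightarrow> real^'m^'m \<Rightarrow> (real^'d \<Rightarrow> 'w \<Rightarrow> real^'m) \<Rightarrow> bool" where
  "self_affine M U V X \<longleftrightarrow>
     contracting U \<and> invertible U \<and> contracting V \<and> invertible V \<and>
     same_fdd M (\<lambda>t. X (U *v t)) (\<lambda>t \<omega>. V *v X t \<omega>) \<and>
     stationary_increments M X \<and>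
     proper_field M X \<and>
     (\<lambda>(t, \<omega>). X t \<omega>) \<in> borel \<Otimes>\<^sub>M M \<rightarrow>\<^sub>M borel"

definition occupation ::
  "(real^'d \<Rightarrow> 'w \<Rightarrow> real^'m) \<Rightarrow> 'w \<Rightarrow> ((real^'d) \<times> (real^'m)) measure" where
  "occupation X \<omega> = distr lborel borel (\<lambda>t. (t, X t \<omega>))"

lemma emeasure_occupation_Times:
  assumes [measurable]: "(\<lambda>t. X t \<omega>) \<in> borel_measurable borel"
    and [measurable]: "A \<in> sets borel" "B \<in> sets borel"
  shows "emeasure (occupation X \<omega>) (A \<times> B) = emeasure lborel {t \<in> A. X t \<omega> \<in> B}"
proof -
  have AB: "A \<times> B \<in> sets borel"
    by (simp flip: borel_prod)
  have [measurable]: "(\<lambda>t. (t, X t \<omega>)) \<in> borel_measurable borel"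
    by (simp flip: borel_prod)
  have "emeasure (occupation X \<omega>) (A \<times> B)
      = emeasure lborel ((\<lambda>t. (t, X t \<omega>)) -` (A \<times> B) \<inter> space lborel)"
    unfolding occupation_def by (rule emeasure_distr) (use AB in auto)
  also have "(\<lambda>t. (t, X t \<omega>)) -` (A \<times> B) \<inter> space lborel = {t \<in> A. X t \<omega> \<in> B}"
    by auto
  finally show ?thesis .
qed

definition occupation_intensity ::
  "'w measure \<Rightarrow> (real^'d \<Rightarrow> 'w \<Rightarrow> real^'m) \<Rightarrow> ((real^'d) \<times> (real^'m)) set \<Rightarrow> ennreal" where
  "occupation_intensity M X A = (\<integral>\<^sup>+ \<omega>. emeasure (occupation X \<omega>) A \<partial>M)"

text \<open>\<open>\<real>\<^sup>d\<^sup>+\<^sup>m\<close> is identified with the product \<open>\<real>\<^sup>d \<times> \<real>\<^sup>m\<close>; the block-diagonal matrix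
  \<open>U \<oplus> V\<close> is the following linear map on it.\<close>
definition block_diag ::
  "real^'d^'d \<Rightarrow> real^'m^'m \<Rightarrow> (real^'d) \<times> (real^'m) \<Rightarrow> (real^'d) \<times> (real^'m)" where
  "block_diag U V = (\<lambda>(x, y). (U *v x, V *v y))"

text \<open>\<open>[-1, 1]\<^sup>d\<^sup>+\<^sup>m\<close>; here \<open>1\<close> is the vector all of whose components are 1.\<close>
definition sym_cube :: "((real^'d) \<times> (real^'m)) set" where
  "sym_cube = cbox (- 1) 1 \<times> cbox (- 1) 1"

definition bci ::
  "'w measure \<Rightarrow> (real^'d \<Rightarrow> 'w \<Rightarrow> real^'m) \<Rightarrow>
     ((real^'d) \<times> (real^'m) \<Rightarrow> (real^'d) \<times> (real^'m)) \<Rightarrow> bool" where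
  "bci M X W \<longleftrightarrow>
     (\<exists>C::real. 0 < C \<and>
        (\<forall>A. A \<in> sets borel \<and> A \<subseteq> sym_cube - W ` sym_cube \<longrightarrow>
           occupation_intensity M X A \<le> ennreal C * emeasure lborel A))"

text \<open>\<open>s(c\<^sup>D, c\<^sup>q)\<close> for a matrix \<open>D\<close> of size \<open>n\<close> whose eigenvalues have the distinct real parts
  \<open>lam 1 < \<dots> < lam p\<close> with multiplicities \<open>mu 1, \<dots>, mu p\<close>. The intervals in \<open>sdim_index\<close>
  are disjoint, so the index is unique if it exists.\<close>

definition sdim_index :: "(nat \<Rightarrow> real) \<Rightarrow> (nat \<Rightarrow> nat) \<Rightarrow> nat \<Rightarrow> real \<Rightarrow> nat \<Rightarrow> bool" where
  "sdim_index lam mu p q l \<longleftrightarrow>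
     l \<in> {1..p} \<and>
     (\<Sum>i = 1..l - 1. lam i * real (mu i)) < q \<and>
     q \<le> (\<Sum>i = 1..l. lam i * real (mu i))"

definition sdim :: "nat \<Rightarrow> (nat \<Rightarrow> real) \<Rightarrow> (nat \<Rightarrow> nat) \<Rightarrow> nat \<Rightarrow> real \<Rightarrow> real" where
  "sdim n lam mu p q =
     (if \<exists>l. sdim_index lam mu p q l
      then let l = (THE l. sdim_index lam mu p q l)
           in 1 / lam l * (q + (\<Sum>i = 1..l. (lam l - lam i) * real (mu i)))
      else real n)"

end

theory Submission
  imports "Jordan_Normal_Form.Schur_Decomposition" Defs
begin

text \<open>The proof is the energy method. If for some \<open>\<gamma>\<close> the image of Lebesgue measure on \<open>[0, 1]\<^sup>d\<close> under
  a path has finite \<open>\<gamma>\<close>-energy, then the range of the path has positive \<open>\<gamma>\<close>-dimensional Hausdorff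
  content. By stationarity of the increments, the expected energy is at most the integral of
  \<open>E |X(t)|\<^sup>-\<^sup>\<gamma>\<close> over \<open>[-1, 1]\<^sup>d\<close>. The sets \<open>W\<^sup>n (Q - W Q)\<close>, where \<open>Q = [-1, 1]\<^sup>d\<^sup>+\<^sup>m\<close>, cover \<open>Q - {0}\<close>; rescaling by
  \<open>W\<^sup>-\<^sup>n\<close> and the b.c.i. condition bound this integral by a multiple of
  \<open>\<Sum>n. c\<^sup>q\<^sup>n * \<integral> |c\<^sup>n\<^sup>D x|\<^sup>-\<^sup>\<gamma> dx\<close>. There are linear coordinates \<open>y = T x\<close> with
  \<open>|c\<^sup>n\<^sup>D x| \<ge> K * c\<^sup>n\<^sup>(\<^sup>\<kappa>\<^sup>j\<^sup>+\<^sup>\<epsilon>\<^sup>) * |y\<^sub>j|\<close> for every \<open>j\<close>, where \<open>\<kappa>\<^sub>j\<close> runs through the real parts of the eigenvalues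
  of \<open>D\<close> with multiplicity. Raising these inequalities to powers \<open>\<eta>\<^sub>j\<close> in \<open>[0, 1)\<close> of total \<open>\<gamma>\<close> and multiplying
  them turns the inner integral into a product of convergent integrals over the line times
  \<open>c\<close> to the power \<open>- n * (\<Sum>j. (\<kappa>\<^sub>j + \<epsilon>) * \<eta>\<^sub>j)\<close>. The series converges as soon as \<open>\<Sum>j. \<kappa>\<^sub>j * \<eta>\<^sub>j < q\<close>, and such
  \<open>\<eta>\<close> exist for every \<open>\<gamma>\<close> below \<open>s(c\<^sup>D, c\<^sup>q)\<close>.\<close>

no_notation vec_index (infixl "$" 100) and scalar_prod (infix "\<bullet>" 70)
  and Order.top ("\<top>\<index>")
hide_const (open) Matrix.vec Matrix.mat Matrix.row Matrix.col Determinant.det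

section \<open>Triangular form, spectrum and matrix exponential\<close>

text \<open>The index type carries no order, so the ranking \<open>h\<close> supplies one.\<close>

definition upper_tri :: "('n \<Rightarrow> nat) \<Rightarrow> 'a::zero^'n^'n \<Rightarrow> bool" where
  "upper_tri h B \<longleftrightarrow> (\<forall>i j. h j < h i \<longrightarrow> B$i$j = 0)"

text \<open>This is the Schur decomposition, carried over from matrices indexed by
  \<open>{0..<n}\<close> along an enumeration \<open>h\<close> of the index type. The diagonal can
  be prescribed in any order. Decreasing real parts are chosen so that, under the inverse of
  \<open>mat_powr c D\<close>, the rows that feed into a given row have growth rates no larger than
  its own.\<close>

lemma complex_triangularization:
  fixes A :: "complex^'n^'n"
  obtains P Q B :: "complex^'n^'n" and h :: "'n \<Rightarrow> nat" where
    "P ** Q = mat 1" "Q ** P = mat 1" "A = P ** B ** Q" "inj h" "upper_tri h B"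
    "\<And>i j. h i \<le> h j \<Longrightarrow> Re (B$j$j) \<le> Re (B$i$i)"
proof -
  define n where "n = CARD('n)"
  obtain h :: "'n \<Rightarrow> nat" where h: "bij_betw h UNIV {0..<n}"
    unfolding n_def using ex_bij_betw_finite_nat[of "UNIV :: 'n set"] by auto
  have injh: "inj h"
    using h by (auto simp: bij_betw_def)
  have h_less [simp]: "h i < n" for i
    using h by (auto simp: bij_betw_def)
  define g where "g = inv_into UNIV h"
  have g [simp]: "g (h i) = i" for i
    using injh by (simp add: g_def)
  define to_mat where "to_mat C = Matrix.mat n n (\<lambda>(i, j). C $ g i $ g j)"
    for C :: "complex^'n^'n"
  define from_mat where "from_mat C = (\<chi> i j. C $$ (h i, h j))" for C :: "complex Matrix.mat"
  have from_to: "from_mat (to_mat C) = C" for C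
    by (simp add: from_mat_def to_mat_def vec_eq_iff injh)
  have from_mult: "from_mat (C * C') = from_mat C ** from_mat C'"
    if "C \<in> carrier_mat n n" "C' \<in> carrier_mat n n" for C C'
  proof -
    have "(C * C') $$ (h i, h j) = (\<Sum>k\<in>UNIV. C $$ (h i, h k) * C' $$ (h k, h j))" for i j
    proof -
      have "(C * C') $$ (h i, h j) = (\<Sum>k\<in>{0..<n}. C $$ (h i, k) * C' $$ (k, h j))"
        using that by (simp add: scalar_prod_def)
      also have "\<dots> = (\<Sum>k\<in>UNIV. C $$ (h i, h k) * C' $$ (h k, h j))"
        by (rule sum.reindex_bij_betw[OF h, symmetric])
      finally show ?thesis .
    qed
    then show ?thesis
      by (simp add: from_mat_def matrix_matrix_mult_def vec_eq_iff)
  qed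
  have from_one: "from_mat (1\<^sub>m n) = mat 1"
    by (auto simp: from_mat_def mat_def vec_eq_iff inj_eq[OF injh])
  have A': "to_mat A \<in> carrier_mat n n"
    by (simp add: to_mat_def)
  obtain as where as: "char_poly (to_mat A) = (\<Prod>a\<leftarrow>as. [:- a, 1:])" "length as = n"
    using char_poly_factorized[OF A'] by auto
  \<comment> \<open>Sorting only permutes the linear factors, so their product is still the
    characteristic polynomial.\<close>
  define es where "es = sort_key (\<lambda>z. - Re z) as"
  have "mset (map (\<lambda>a. [:- a, 1:]) es) = mset (map (\<lambda>a. [:- a, 1:]) as)"
    by (simp add: es_def)
  then have es: "char_poly (to_mat A) = (\<Prod>a\<leftarrow>es. [:- a, 1:])"
    unfolding as(1) by (metis prod_mset_prod_list)
  have len: "length es = n"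
    by (simp add: es_def as)
  have sorted: "sorted (map (\<lambda>z. - Re z) es)"
    by (simp add: es_def)
  obtain B P Q where BPQ: "schur_decomposition (to_mat A) es = (B, P, Q)"
    by (metis prod_cases3)
  note sd = schur_decomposition[OF A' es BPQ]
  note w = similar_mat_witD2[OF A' conjunct1[OF sd]]
  have ut: "upper_triangular B" and diag: "diag_mat B = es"
    using sd by auto
  have dimB: "dim_row B = n"
    using w(5) by auto
  show thesis
  proof (rule that[of "from_mat P" "from_mat Q" "from_mat B" h])
    show "from_mat P ** from_mat Q = mat 1" "from_mat Q ** from_mat P = mat 1"
      using from_mult[OF w(6,7)] from_mult[OF w(7,6)] w(1,2) from_one by auto
    have "P * B \<in> carrier_mat n n"
      using w by auto
    then show "A = from_mat P ** from_mat B ** from_mat Q"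
      using from_to[of A] w(3) from_mult[OF w(6,5)] from_mult[of "P * B" Q] w(7) by simp
    show "inj h" by fact
    show "upper_tri h (from_mat B)"
      using ut by (auto simp: upper_tri_def from_mat_def dimB upper_triangular_def)
    show "Re (from_mat B$j$j) \<le> Re (from_mat B$i$i)" if "h i \<le> h j" for i j
    proof -
      have "B $$ (h k, h k) = es ! h k" for k
        unfolding diag[symmetric] by (simp add: diag_mat_def dimB)
      moreover have "map (\<lambda>z. - Re z) es ! h i \<le> map (\<lambda>z. - Re z) es ! h j"
        using sorted that by (intro sorted_nth_mono) (auto simp: len)
      ultimately show ?thesis
        by (simp add: from_mat_def len)
    qed
  qed
qed

text \<open>In the Leibniz formula every permutation other than the identity lowers the rank
  somewhere: otherwise \<open>h i \<le> h (p i)\<close> for all \<open>i\<close>, and since both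
  sides have the same sum, equality would hold throughout. Its product therefore contains an entry
  below the diagonal.\<close>

lemma det_upper_tri:
  fixes B :: "'a::comm_ring_1^'n^'n"
  assumes "upper_tri h B" "inj h"
  shows "det B = (\<Prod>i\<in>UNIV. B$i$i)"
proof -
  have zero: "(\<Prod>i\<in>UNIV. B$i$p i) = 0" if "p permutes UNIV" "p \<noteq> id" for p
  proof -
    have "\<exists>i. h (p i) < h i"
    proof (rule ccontr)
      assume "\<nexists>i. h (p i) < h i"
      then have le: "\<And>i. h i \<le> h (p i)" by (simp add: not_less)
      have "(\<Sum>i\<in>UNIV. h (p i)) = (\<Sum>i\<in>UNIV. h i)"
        using sum.permute[OF that(1), of h] by (simp add: o_def)
      then have "h (p i) = h i" for i
        using sum_mono_inv[of h UNIV "\<lambda>i. h (p i)"] le by (metis UNIV_I finite)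
      then show False
        using that(2) assms(2) by (auto simp: inj_eq fun_eq_iff)
    qed
    then show ?thesis
      using assms(1) by (auto simp: upper_tri_def intro!: prod_zero)
  qed
  have "det B = (\<Sum>p\<in>{id}. of_int (sign p) * (\<Prod>i\<in>UNIV. B$i$p i))"
    unfolding det_def
    by (rule sum.mono_neutral_right) (auto simp: zero permutes_id)
  then show ?thesis by simp
qed

lemma upper_tri_mult:
  fixes B C :: "'a::semiring_1^'n^'n"
  assumes "upper_tri h B" "upper_tri h C" "inj h"
  shows "upper_tri h (B ** C)" and "(B ** C)$i$i = B$i$i * C$i$i"
proof -
  have B: "B$i$j = 0" if "h j < h i" for i j
    using assms that by (auto simp: upper_tri_def)
  have C: "C$i$j = 0" if "h j < h i" for i j
    using assms that by (auto simp: upper_tri_def)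
  show "upper_tri h (B ** C)"
    unfolding upper_tri_def
  proof (intro allI impI)
    fix i j assume "h j < h i"
    then have "B$i$k * C$k$j = 0" for k
      using B[of k i] C[of j k] by (cases "h k < h i") auto
    then show "(B ** C)$i$j = 0"
      by (simp add: matrix_matrix_mult_def)
  qed
  have "B$i$k * C$k$i = 0" if "k \<noteq> i" for k
  proof (cases "h k < h i")
    case False
    then have "h i < h k"
      using that assms(3) by (metis injD linorder_less_linear)
    then show ?thesis by (simp add: C)
  qed (simp add: B)
  then have "(\<Sum>k\<in>UNIV. B$i$k * C$k$i) = (\<Sum>k\<in>{i}. B$i$k * C$k$i)"
    by (intro sum.mono_neutral_right) auto
  then show "(B ** C)$i$i = B$i$i * C$i$i"
    by (simp add: matrix_matrix_mult_def)
qed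

section \<open>Characteristic polynomial, eigenvalues and multiplicities\<close>

lemma poly_charpoly:
  "poly (charpoly A) z = det (mat z - cmat A)"
proof -
  let ?M = "mat [:0, 1:] - map_matrix (\<lambda>a. [:a:]) (cmat A)"
  have "poly (?M $ i $ j) z = (mat z - cmat A) $ i $ j" for i j
    by (simp add: mat_def map_matrix_def)
  then show ?thesis
    unfolding charpoly_def det_def by (simp add: poly_sum poly_prod)
qed

lemma det_conjugate:
  fixes P :: "'a::comm_ring_1^'n^'n"
  assumes "P ** Q = mat 1"
  shows "det (P ** B ** Q) = det B"
proof -
  have "det P * det Q = 1"
    using assms by (metis det_I det_mul)
  then show ?thesis
    by (simp add: det_mul algebra_simps)
qed

lemma mat_commute:
  fixes P :: "'a::comm_semiring_1^'n^'n"
  shows "P ** mat z = mat z ** P"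
proof -
  have "P$i$k * (if k = j then z else 0) = (if k = j then P$i$j * z else 0)"
    "(if i = k then z else 0) * P$k$j = (if i = k then P$i$j * z else 0)" for i j k
    by (auto simp: mult.commute)
  then show ?thesis
    by (simp add: vec_eq_iff matrix_matrix_mult_def mat_def)
qed

lemma matrix_mult_diff_distrib:
  fixes A B C :: "'a::ring_1^'n^'n"
  shows "A ** (B - C) = A ** B - A ** C" "(B - C) ** A = B ** A - C ** A"
  by (simp_all add: vec_eq_iff matrix_matrix_mult_def algebra_simps sum_subtractf)

text \<open>The two polynomials are compared by their values. At each \<open>z\<close> the
  similarity reduces \<open>mat z - cmat A\<close> to a triangular complex matrix, so no similarity
  of polynomial matrices is involved.\<close>

lemma charpoly_triangular:
  fixes A :: "real^'n^'n" and P B Q :: "complex^'n^'n"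
  assumes A: "cmat A = P ** B ** Q" and PQ: "P ** Q = mat 1" and B: "upper_tri h B" "inj h"
  shows "charpoly A = (\<Prod>i\<in>UNIV. [:- (B$i$i), 1:])"
proof -
  have "poly (charpoly A) z = poly (\<Prod>i\<in>UNIV. [:- (B$i$i), 1:]) z" for z
  proof -
    have "P ** mat z ** Q = mat z"
      by (simp only: mat_commute[of P z] matrix_mul_assoc[symmetric] PQ matrix_mul_rid)
    then have "mat z - cmat A = P ** (mat z - B) ** Q"
      by (simp add: A matrix_mult_diff_distrib)
    then have "det (mat z - cmat A) = det (mat z - B)"
      by (simp add: det_conjugate[OF PQ])
    also have "\<dots> = (\<Prod>i\<in>UNIV. (mat z - B)$i$i)"
      using B by (intro det_upper_tri) (auto simp: upper_tri_def mat_def)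
    finally show ?thesis
      by (simp add: poly_charpoly poly_prod mat_def)
  qed
  then show ?thesis
    using poly_eq_poly_eq_iff by blast
qed

lemma ceigenvalue_iff_charpoly: "ceigenvalue A z \<longleftrightarrow> poly (charpoly A) z = 0"
proof -
  have "ceigenvalue A z \<longleftrightarrow> (\<exists>v. v \<noteq> 0 \<and> (mat z - cmat A) *v v = 0)"
  proof -
    have "mat z *v v = z *s v" for v :: "complex^'a"
    proof -
      have "(if i = k then z else 0) * v$k = (if i = k then z * v$i else 0)" for i k
        by auto
      then show ?thesis
        by (simp add: vec_eq_iff matrix_vector_mult_def mat_def)
    qed
    then show ?thesis
      unfolding ceigenvalue_def by (simp add: matrix_vector_mult_diff_rdistrib) metis
  qed
  also have "\<dots> \<longleftrightarrow> \<not> invertible (mat z - cmat A)"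
    unfolding invertible_left_inverse matrix_left_invertible_ker by auto
  finally show ?thesis
    by (simp add: poly_charpoly invertible_det_nz)
qed

lemma ceigenvalue_triangular:
  fixes A :: "real^'n^'n" and P B Q :: "complex^'n^'n"
  assumes "cmat A = P ** B ** Q" "P ** Q = mat 1" "upper_tri h B" "inj h"
  shows "ceigenvalue A z \<longleftrightarrow> (\<exists>i. z = B$i$i)"
  by (auto simp: ceigenvalue_iff_charpoly charpoly_triangular[OF assms] poly_prod)

lemma order_prod:
  fixes f :: "'b \<Rightarrow> 'a::idom poly"
  assumes "finite I" "\<And>i. i \<in> I \<Longrightarrow> f i \<noteq> 0"
  shows "order z (\<Prod>i\<in>I. f i) = (\<Sum>i\<in>I. order z (f i))"
  using assms
proof (induction I rule: finite_induct)
  case (insert i I)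
  then have "f i * prod f I \<noteq> 0"
    by (simp add: prod_zero_iff)
  then show ?case
    using insert by (simp add: order_mult)
qed (simp add: order_0I)

text \<open>Each diagonal entry contributes one linear factor, so the order of a root counts its
  occurrences on the diagonal; the positions belonging to different roots are disjoint.\<close>

lemma re_multiplicity_triangular:
  fixes A :: "real^'n^'n" and P B Q :: "complex^'n^'n"
  assumes "cmat A = P ** B ** Q" "P ** Q = mat 1" "upper_tri h B" "inj h"
  shows "re_multiplicity A r = card {i. Re (B$i$i) = r}"
proof -
  have ord: "order z (charpoly A) = card {i. B$i$i = z}" for z
  proof -
    have "order z (charpoly A) = (\<Sum>i\<in>UNIV. order z [:- (B$i$i), 1:])"
      unfolding charpoly_triangular[OF assms] by (rule order_prod) auto
    also have "\<dots> = (\<Sum>i\<in>UNIV. if B$i$i = z then 1 else 0)"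
      by (intro sum.cong refl) (auto simp: order_linear' order_0I)
    finally show ?thesis
      by (simp add: sum.If_cases)
  qed
  have "re_multiplicity A r = (\<Sum>z\<in>{z. (\<exists>i. z = B$i$i) \<and> Re z = r}. card {i. B$i$i = z})"
    by (simp add: re_multiplicity_def ceigenvalue_triangular[OF assms] ord)
  also have "\<dots> = card (\<Union>z\<in>{z. (\<exists>i. z = B$i$i) \<and> Re z = r}. {i. B$i$i = z})"
  proof (rule card_UN_disjoint[symmetric])
    have "{z. (\<exists>i. z = B$i$i) \<and> Re z = r} \<subseteq> range (\<lambda>i. B$i$i)" by auto
    then show "finite {z. (\<exists>i. z = B$i$i) \<and> Re z = r}"
      by (rule finite_subset) simp
  qed auto
  also have "(\<Union>z\<in>{z. (\<exists>i. z = B$i$i) \<and> Re z = r}. {i. B$i$i = z}) = {i. Re (B$i$i) = r}"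
    by auto
  finally show ?thesis .
qed

lemma trace_triangular:
  fixes A :: "real^'n^'n" and P B Q :: "complex^'n^'n"
  assumes "cmat A = P ** B ** Q" "Q ** P = mat 1"
  shows "complex_of_real (trace A) = (\<Sum>i\<in>UNIV. B$i$i)"
proof -
  have "complex_of_real (trace A) = trace (cmat A)"
    by (simp add: trace_def cmat_def map_matrix_def)
  also have "\<dots> = trace (Q ** (P ** B))"
    unfolding assms(1) by (rule trace_mul_sym)
  also have "\<dots> = trace B"
    by (simp only: matrix_mul_assoc assms(2) matrix_mul_lid)
  finally show ?thesis by (simp add: trace_def)
qed

section \<open>Matrix exponentials in triangular form\<close>

lemma bounded_linear_mult_mult_cmat:
  fixes P Q :: "complex^'n^'n"
  shows "bounded_linear (\<lambda>A. Q ** cmat A ** P)"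
proof -
  have "linear (\<lambda>A. Q ** cmat A ** P)"
    by (rule linearI)
      (simp_all add: cmat_def map_matrix_def matrix_matrix_mult_def vec_eq_iff sum.distrib
        sum_distrib_left sum_distrib_right algebra_simps scaleR_conv_of_real[where 'a=complex])
  then show ?thesis
    by (simp add: linear_conv_bounded_linear)
qed

lemma bounded_bilinear_matrix_matrix_mult:
  "bounded_bilinear ((**) :: real^'n^'n \<Rightarrow> real^'n^'n \<Rightarrow> real^'n^'n)"
proof -
  have "bilinear ((**) :: real^'n^'n \<Rightarrow> real^'n^'n \<Rightarrow> real^'n^'n)"
    unfolding bilinear_def
    by (auto intro!: linearI simp: matrix_matrix_mult_def vec_eq_iff sum.distrib
        sum_distrib_left algebra_simps)
  then show ?thesis
    by (simp add: bilinear_conv_bounded_bilinear)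
qed

text \<open>Boundedness of the bilinear product majorises the series by the real exponential series
  at \<open>norm A * K\<close>, up to the factor \<open>norm (mat 1)\<close>.\<close>

lemma summable_mat_exp:
  fixes A :: "real^'n^'n"
  shows "summable (\<lambda>k. mat_pow A k /\<^sub>R fact k)"
proof -
  obtain K where K: "K \<ge> 0" "\<And>(A :: real^'n^'n) (B :: real^'n^'n). norm (A ** B) \<le> norm A * norm B * K"
    using bounded_bilinear.nonneg_bounded[OF bounded_bilinear_matrix_matrix_mult] by auto
  have le: "norm (mat_pow A k) \<le> norm (mat 1 :: real^'n^'n) * (norm A * K) ^ k" for k
  proof (induction k)
    case (Suc k)
    have "norm (mat_pow A (Suc k)) \<le> norm A * K * norm (mat_pow A k)"
      using K(2)[of A "mat_pow A k"] by (simp add: algebra_simps)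
    also have "\<dots> \<le> norm A * K * (norm (mat 1 :: real^'n^'n) * (norm A * K) ^ k)"
      using K(1) by (intro mult_left_mono Suc) auto
    finally show ?case by (simp add: algebra_simps)
  qed simp
  show ?thesis
  proof (rule summable_comparison_test')
    show "summable (\<lambda>k. norm (mat 1 :: real^'n^'n) * ((norm A * K) ^ k /\<^sub>R fact k))"
      by (intro summable_mult summable_exp_generic)
    show "norm (mat_pow A k /\<^sub>R fact k) \<le> norm (mat 1 :: real^'n^'n) * ((norm A * K) ^ k /\<^sub>R fact k)" for k
      using le[of k] by (simp add: divide_simps)
  qed
qed

text \<open>The conjugation \<open>R\<close> is bounded linear and so passes through the exponential
  series. It turns powers of \<open>A\<close> into powers of \<open>B\<close>, which stay triangular
  and have the powers of the diagonal of \<open>B\<close> on their diagonal; both claims then follow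
  entry by entry.\<close>

lemma mat_exp_triangular:
  fixes A :: "real^'n^'n" and P B Q :: "complex^'n^'n"
  assumes A: "cmat A = P ** B ** Q" and QP: "Q ** P = mat 1" and B: "upper_tri h B" "inj h"
  shows "upper_tri h (Q ** cmat (mat_exp A) ** P)"
    and "(Q ** cmat (mat_exp A) ** P)$i$i = exp (B$i$i)"
proof -
  define R where "R A = Q ** cmat A ** P" for A
  interpret R: bounded_linear R
    unfolding R_def by (rule bounded_linear_mult_mult_cmat)
  have R_pow: "upper_tri h (R (mat_pow A k)) \<and> (\<forall>i. R (mat_pow A k)$i$i = B$i$i ^ k)" for k
  proof (induction k)
    case 0
    have "cmat (mat 1 :: real^'n^'n) = mat 1"
      by (simp add: cmat_def map_matrix_def mat_def vec_eq_iff)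
    then have "R (mat_pow A 0) = mat 1"
      by (simp add: R_def QP)
    then show ?case
      by (auto simp: upper_tri_def mat_def)
  next
    case (Suc k)
    have "cmat (A ** mat_pow A k) = cmat A ** cmat (mat_pow A k)"
      by (simp add: cmat_def map_matrix_def matrix_matrix_mult_def vec_eq_iff)
    then have "R (mat_pow A (Suc k)) = (Q ** P) ** B ** R (mat_pow A k)"
      by (simp only: mat_pow.simps R_def A matrix_mul_assoc)
    then have "R (mat_pow A (Suc k)) = B ** R (mat_pow A k)"
      by (simp only: QP matrix_mul_lid)
    then show ?case
      using upper_tri_mult[OF B(1) conjunct1[OF Suc] B(2)] Suc by auto
  qed
  have entry: "(\<lambda>k. R (mat_pow A k)$i$j /\<^sub>R fact k) sums (R (mat_exp A)$i$j)" for i j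
  proof -
    have "(\<lambda>k. R (mat_pow A k /\<^sub>R fact k)) sums R (mat_exp A)"
      unfolding mat_exp_def by (intro R.sums summable_sums summable_mat_exp)
    then have "(\<lambda>k. R (mat_pow A k /\<^sub>R fact k)$i$j) sums (R (mat_exp A)$i$j)"
      by (intro bounded_linear.sums[OF bounded_linear_vec_nth])
    then show ?thesis
      by (simp add: R.scaleR)
  qed
  show "upper_tri h (Q ** cmat (mat_exp A) ** P)"
    unfolding upper_tri_def R_def[symmetric]
  proof (intro allI impI)
    fix i j assume "h j < h i"
    then have "R (mat_pow A k)$i$j = 0" for k
      using R_pow[of k] by (auto simp: upper_tri_def)
    then show "R (mat_exp A)$i$j = 0"
      using entry[of i j] by (simp add: sums_iff)
  qed
  have "(\<lambda>k. B$i$i ^ k /\<^sub>R fact k) sums (R (mat_exp A)$i$i)"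
    using entry[of i i] R_pow by simp
  then show "(Q ** cmat (mat_exp A) ** P)$i$i = exp (B$i$i)"
    unfolding R_def using exp_converges sums_unique2 by blast
qed

lemma mat_powr_triangular:
  fixes A :: "real^'n^'n" and P B Q :: "complex^'n^'n"
  assumes A: "cmat A = P ** B ** Q" and QP: "Q ** P = mat 1" and B: "upper_tri h B" "inj h"
  shows "upper_tri h (Q ** cmat (mat_powr c A) ** P)"
    and "(Q ** cmat (mat_powr c A) ** P)$i$i = exp (complex_of_real (ln c) * B$i$i)"
proof -
  define B' where "B' = (\<chi> i j. complex_of_real (ln c) * B$i$j)"
  have "cmat (ln c *\<^sub>R A) = P ** B' ** Q"
  proof -
    have "cmat (ln c *\<^sub>R A) = (\<chi> i j. complex_of_real (ln c) * (P ** B ** Q)$i$j)"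
      unfolding A[symmetric] by (simp add: cmat_def map_matrix_def vec_eq_iff)
    then show ?thesis
      by (simp add: B'_def matrix_matrix_mult_def vec_eq_iff sum_distrib_left sum_distrib_right
          mult.assoc mult.left_commute[of _ "complex_of_real (ln c)"])
  qed
  moreover have "upper_tri h B'"
    using B(1) by (simp add: B'_def upper_tri_def)
  ultimately show "upper_tri h (Q ** cmat (mat_powr c A) ** P)"
    and "(Q ** cmat (mat_powr c A) ** P)$i$i = exp (complex_of_real (ln c) * B$i$i)"
    using mat_exp_triangular[of "ln c *\<^sub>R A" P B' Q h] QP B(2)
    by (simp_all add: mat_powr_def B'_def)
qed

lemma det_cmat: "det (cmat A) = complex_of_real (det A)"
  by (simp add: det_def cmat_def map_matrix_def)

text \<open>The triangular form of \<open>mat_powr c A\<close> has diagonal entries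
  \<open>exp (ln c * z)\<close> for the eigenvalues \<open>z\<close> of \<open>A\<close>, and the
  product of exponentials collects the trace in the exponent.\<close>

lemma det_mat_powr:
  fixes A :: "real^'n^'n"
  assumes "c > 0"
  shows "det (mat_powr c A) = c powr trace A"
proof -
  obtain P Q B :: "complex^'n^'n" and h :: "'n \<Rightarrow> nat" where
    PQ: "P ** Q = mat 1" "Q ** P = mat 1" and A: "cmat A = P ** B ** Q" and h: "inj h" "upper_tri h B"
    using complex_triangularization[of "cmat A"] by metis
  note G = mat_powr_triangular[OF A PQ(2) h(2,1), of c]
  have "complex_of_real (det (mat_powr c A)) = det (Q ** cmat (mat_powr c A) ** P)"
    by (simp add: det_conjugate[OF PQ(2)] det_cmat)
  also have "\<dots> = (\<Prod>i\<in>UNIV. exp (complex_of_real (ln c) * B$i$i))"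
    using det_upper_tri[OF G(1) h(1)] by (simp add: G(2))
  also have "\<dots> = exp (complex_of_real (ln c) * complex_of_real (trace A))"
    by (simp add: trace_triangular[OF A PQ(2)] exp_sum sum_distrib_left)
  also have "\<dots> = complex_of_real (c powr trace A)"
    using assms by (simp add: powr_def exp_of_real[symmetric] mult.commute)
  finally show ?thesis
    by (simp only: of_real_eq_iff)
qed

section \<open>Growth of matrix powers in coordinates\<close>

text \<open>Covers both a recursion \<open>u (n + 1) = G u n\<close> and its inverse \<open>u n = G u (n + 1)\<close>
  for a triangular matrix \<open>G\<close>.\<close>
lemma triangular_recursion_growth:
  fixes h :: "'n::finite \<Rightarrow> nat" and \<rho> :: "'n \<Rightarrow> real"
  assumes "M \<ge> 0" "r > 0" "\<And>i. \<rho> i \<ge> 0" "\<And>k. h k \<ge> h i \<Longrightarrow> \<rho> k < r"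
  shows "\<exists>K\<ge>0. \<forall>u :: nat \<Rightarrow> 'n \<Rightarrow> real. (\<forall>n i. 0 \<le> u n i) \<longrightarrow>
     (\<forall>n i. u (Suc n) i \<le> \<rho> i * u n i + M * (\<Sum>l\<in>{l. h l > h i}. u (Suc n) l + u n l)) \<longrightarrow>
     (\<forall>n. u n i \<le> K * r ^ n * (\<Sum>l\<in>UNIV. u 0 l))"
  using assms(4)
\<comment> \<open>Rows are treated from the largest rank downwards, because row \<open>i\<close> is
  forced only by rows of larger rank. \<open>K\<close> is chosen before \<open>u\<close>, so one
  constant serves all starting points.\<close>
proof (induction "Max (range h) - h i" arbitrary: i rule: less_induct)
  case less
  define rec where "rec u \<longleftrightarrow> (\<forall>n i. 0 \<le> u n i) \<and>
     (\<forall>n i. u (Suc n) i \<le> \<rho> i * u n i + M * (\<Sum>l\<in>{l. h l > h i}. u (Suc n) l + u n l))"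
    for u :: "nat \<Rightarrow> 'n \<Rightarrow> real"
  have "\<exists>K\<ge>0. \<forall>u. rec u \<longrightarrow> (\<forall>n. u n l \<le> K * r ^ n * (\<Sum>l\<in>UNIV. u 0 l))" if "h l > h i" for l
  proof -
    have "h l \<le> Max (range h)"
      by (intro Max_ge) auto
    then have "Max (range h) - h l < Max (range h) - h i"
      using that by linarith
    moreover have "\<rho> k < r" if "h k \<ge> h l" for k
      using less(2)[of k] that \<open>h l > h i\<close> by simp
    ultimately show ?thesis
      using less(1)[of l] unfolding rec_def by blast
  qed
  then obtain K where K: "\<And>l. h l > h i \<Longrightarrow> K l \<ge> 0"
    "\<And>l u n. h l > h i \<Longrightarrow> rec u \<Longrightarrow> u n l \<le> K l * r ^ n * (\<Sum>l\<in>UNIV. u 0 l)"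
    by metis
  define K' where "K' = M * (\<Sum>l\<in>{l. h l > h i}. K l * r + K l)"
  have K': "K' \<ge> 0"
    unfolding K'_def using assms(1,2) K(1) by (intro mult_nonneg_nonneg sum_nonneg) auto
  have \<rho>: "\<rho> i < r" using less(2) by simp
  \<comment> \<open>With this \<open>L\<close> the sequence \<open>L * r ^ n\<close> absorbs both
    the diagonal term and the forcing by higher rows; the maximum with 1 settles
    \<open>n = 0\<close>.\<close>
  define L where "L = max 1 (K' / (r - \<rho> i))"
  have L: "L \<ge> 1" "\<rho> i * L + K' \<le> r * L"
  proof -
    have "K' / (r - \<rho> i) \<le> L" by (simp add: L_def)
    then have "K' \<le> L * (r - \<rho> i)"
      using \<rho> by (simp add: divide_le_eq)
    then show "\<rho> i * L + K' \<le> r * L" by (simp add: algebra_simps)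
  qed (simp add: L_def)
  have "u n i \<le> L * r ^ n * (\<Sum>l\<in>UNIV. u 0 l)" if u: "rec u" for u n
  proof (induction n)
    case 0
    have N: "0 \<le> (\<Sum>l\<in>UNIV. u 0 l)"
      using u by (intro sum_nonneg) (auto simp: rec_def)
    have "u 0 i \<le> (\<Sum>l\<in>UNIV. u 0 l)"
      using u by (intro member_le_sum) (auto simp: rec_def)
    also have "\<dots> \<le> L * (\<Sum>l\<in>UNIV. u 0 l)"
      using mult_right_mono[OF L(1) N] by simp
    finally show ?case by simp
  next
    case (Suc n)
    define N where "N = (\<Sum>l\<in>UNIV. u 0 l)"
    have N: "N \<ge> 0"
      unfolding N_def using u by (intro sum_nonneg) (auto simp: rec_def)
    have "u (Suc n) i \<le> \<rho> i * u n i + M * (\<Sum>l\<in>{l. h l > h i}. u (Suc n) l + u n l)"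
      using u by (auto simp: rec_def)
    also have "\<dots> \<le> \<rho> i * (L * r ^ n * N) + M * (\<Sum>l\<in>{l. h l > h i}. (K l * r + K l) * (r ^ n * N))"
    proof (intro add_mono mult_left_mono sum_mono)
      fix l assume "l \<in> {l. h l > h i}"
      then show "u (Suc n) l + u n l \<le> (K l * r + K l) * (r ^ n * N)"
        using K(2)[of l u "Suc n"] K(2)[of l u n] u by (simp add: N_def algebra_simps)
    qed (use assms Suc N_def in auto)
    also have "\<dots> = (\<rho> i * L + K') * (r ^ n * N)"
      by (simp add: K'_def sum_distrib_right[symmetric] distrib_right mult.assoc)
    also have "\<dots> \<le> (r * L) * (r ^ n * N)"
      using L(2) assms(2) N by (intro mult_right_mono) auto
    finally show ?case by (simp add: N_def algebra_simps)
  qed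
  then show ?case
    unfolding rec_def using L(1) by (intro exI[of _ L]) auto
qed

section \<open>Iterates of matrix powers in complex and real coordinates\<close>

abbreviation cvec :: "real^'n \<Rightarrow> complex^'n" where
  "cvec x \<equiv> \<chi> i. complex_of_real (x$i)"

lemma cmat_mult_cvec: "cmat A *v cvec x = cvec (A *v x)"
  by (simp add: cmat_def map_matrix_def matrix_vector_mult_def vec_eq_iff)

lemma norm_cvec: "norm (cvec x) = norm x"
  by (simp add: norm_vec_def)

lemma norm_mult_cvec_le:
  fixes Q :: "complex^'n^'n"
  obtains K where "K > 0" "\<And>x i. norm ((Q *v cvec x)$i) \<le> K * norm x"
proof -
  have "linear (\<lambda>x. Q *v cvec x)"
    by (rule linearI) (simp_all add: matrix_vector_mult_def vec_eq_iff sum.distrib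
        sum_distrib_left algebra_simps scaleR_conv_of_real[where 'a=complex])
  then have "bounded_linear (\<lambda>x. Q *v cvec x)"
    by (simp add: linear_conv_bounded_linear)
  then obtain K where K: "K > 0" "\<And>x. norm (Q *v cvec x) \<le> norm x * K"
    using bounded_linear.pos_bounded by blast
  show thesis
  proof (rule that[OF K(1)])
    show "norm ((Q *v cvec x)$i) \<le> K * norm x" for x i
      using Finite_Cartesian_Product.norm_nth_le[of "Q *v cvec x" i] K(2)[of x]
      by (simp add: mult.commute)
  qed
qed

text \<open>In triangular coordinates the diagonal entries of \<open>mat_powr c E\<close> have
  modulus \<open>c\<close> to the power of a positive real part, hence less than 1. The recursion
  estimate turns this into geometric decay of all coordinates.\<close>

lemma mat_powr_contracts:
  fixes E :: "real^'n^'n"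
  assumes E: "\<And>z. ceigenvalue E z \<Longrightarrow> 0 < Re z" and c: "0 < c" "c < 1"
  obtains K r where "0 < r" "r < 1" "\<And>n x. norm ((((*v) (mat_powr c E)) ^^ n) x) \<le> K * r ^ n * norm x"
proof -
  obtain P Q B :: "complex^'n^'n" and h :: "'n \<Rightarrow> nat" where
    PQ: "P ** Q = mat 1" "Q ** P = mat 1" and A: "cmat E = P ** B ** Q" and h: "inj h" "upper_tri h B"
    using complex_triangularization[of "cmat E"] by metis
  define V where "V = mat_powr c E"
  define G where "G = Q ** cmat V ** P"
  have G: "upper_tri h G" "\<And>i. G$i$i = exp (complex_of_real (ln c) * B$i$i)"
    unfolding G_def V_def by (rule mat_powr_triangular[OF A PQ(2) h(2,1)])+
  define \<rho> where "\<rho> i = cmod (G$i$i)" for i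
  have \<rho>: "\<rho> i < 1" for i
  proof -
    have "0 < Re (B$i$i)"
      using ceigenvalue_triangular[OF A PQ(1) h(2,1)] E by blast
    then show ?thesis
      using c by (simp add: \<rho>_def G(2) mult_neg_pos)
  qed
  define m where "m = Max (insert 0 (range \<rho>))"
  \<comment> \<open>The midpoint between \<open>m\<close> and 1 leaves the strict gap above every
    \<open>\<rho> i\<close> that the recursion estimate demands.\<close>
  define r where "r = (m + 1) / 2"
  have "m < 1"
    unfolding m_def using \<rho> by (subst Max_less_iff) auto
  have m: "\<rho> i \<le> m" "0 \<le> m" for i
    unfolding m_def by (intro Max_ge; simp)+
  have r: "0 < r" "r < 1" "\<rho> i < r" for i
  proof -
    show "0 < r" "r < 1"
      using \<open>m < 1\<close> m(2) by (simp_all add: r_def)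
    have "m < r"
      using \<open>m < 1\<close> by (simp add: r_def)
    then show "\<rho> i < r"
      using m(1) by (rule le_less_trans[rotated])
  qed
  define M where "M = Max (range (\<lambda>(i, j). cmod (G$i$j)))"
  have M: "cmod (G$i$j) \<le> M" for i j
    unfolding M_def by (intro Max_ge) (auto intro!: image_eqI[of _ _ "(i, j)"])
  then have M0: "M \<ge> 0"
    using norm_ge_zero order_trans by blast
  define rec where "rec u \<longleftrightarrow> (\<forall>n i. 0 \<le> u n i) \<and>
     (\<forall>n i. u (Suc n) i \<le> \<rho> i * u n i + M * (\<Sum>l\<in>{l. h l > h i}. u (Suc n) l + u n l))"
    for u :: "nat \<Rightarrow> 'n \<Rightarrow> real"
  have "\<forall>i. \<exists>K. K \<ge> 0 \<and> (\<forall>u n. rec u \<longrightarrow> u n i \<le> K * r ^ n * (\<Sum>l\<in>UNIV. u 0 l))"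
  proof
    fix i
    have "\<exists>K\<ge>0. \<forall>u :: nat \<Rightarrow> 'n \<Rightarrow> real. (\<forall>n i. 0 \<le> u n i) \<longrightarrow>
     (\<forall>n i. u (Suc n) i \<le> \<rho> i * u n i + M * (\<Sum>l\<in>{l. h l > h i}. u (Suc n) l + u n l)) \<longrightarrow>
     (\<forall>n. u n i \<le> K * r ^ n * (\<Sum>l\<in>UNIV. u 0 l))"
      by (rule triangular_recursion_growth) (use M0 r \<rho>_def in auto)
    then show "\<exists>K. K \<ge> 0 \<and> (\<forall>u n. rec u \<longrightarrow> u n i \<le> K * r ^ n * (\<Sum>l\<in>UNIV. u 0 l))"
      unfolding rec_def by blast
  qed
  from choice[OF this] obtain K where K: "\<And>i. K i \<ge> 0"
    "\<And>i u n. rec u \<Longrightarrow> u n i \<le> K i * r ^ n * (\<Sum>l\<in>UNIV. u 0 l)"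
    by blast
  obtain L where L: "L > 0" "\<And>x i. norm ((Q *v cvec x)$i) \<le> L * norm x"
    using norm_mult_cvec_le[of Q] by blast
  have "bounded_linear ((*v) P)"
    by (intro linear_conv_bounded_linear[THEN iffD1] linearI)
       (simp_all add: matrix_vector_mult_def vec_eq_iff sum.distrib
        scaleR_sum_right algebra_simps)
  then obtain L' where L': "L' > 0" "\<And>z. norm (P *v z) \<le> norm z * L'"
    using bounded_linear.pos_bounded by blast
  have bound: "norm ((((*v) V) ^^ n) x) \<le> ((\<Sum>i\<in>UNIV. K i) * (CARD('n) * L) * L') * r ^ n * norm x" for n x
  proof -
    define u where "u n = Q *v cvec ((((*v) V) ^^ n) x)" for n
    have P_u: "P *v u n = cvec ((((*v) V) ^^ n) x)" for n
      by (simp add: u_def matrix_vector_mul_assoc PQ(1))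
    have u_Suc: "u (Suc n) = G *v u n" for n
    proof -
      have "u (Suc n) = Q *v (cmat V *v (P *v u n))"
        unfolding P_u by (simp add: u_def cmat_mult_cvec)
      then show ?thesis
        by (simp add: G_def matrix_vector_mul_assoc matrix_mul_assoc)
    qed
    have step: "cmod (u (Suc n) $ i) \<le> \<rho> i * cmod (u n $ i)
       + M * (\<Sum>l\<in>{l. h l > h i}. cmod (u (Suc n) $ l) + cmod (u n $ l))" for n i
    proof -
      have "u (Suc n) $ i = (\<Sum>l\<in>UNIV. G$i$l * u n $ l)"
        by (simp add: u_Suc matrix_vector_mult_def)
      also have "\<dots> = (\<Sum>l\<in>insert i {l. h l > h i}. G$i$l * u n $ l)"
      proof (intro sum.mono_neutral_right ballI)
        fix l assume "l \<in> UNIV - insert i {l. h l > h i}"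
        then have "h l < h i"
          using h(1) by (auto simp: not_less le_less inj_eq)
        then show "G$i$l * u n $ l = 0"
          using G(1) by (simp add: upper_tri_def)
      qed auto
      also have "\<dots> = G$i$i * u n $ i + (\<Sum>l\<in>{l. h l > h i}. G$i$l * u n $ l)"
        by (subst sum.insert) auto
      also have "cmod \<dots> \<le> \<rho> i * cmod (u n $ i) + (\<Sum>l\<in>{l. h l > h i}. cmod (G$i$l * u n $ l))"
        unfolding \<rho>_def by (intro order_trans[OF norm_triangle_ineq] add_mono norm_sum) (simp add: norm_mult)
      also have "(\<Sum>l\<in>{l. h l > h i}. cmod (G$i$l * u n $ l)) \<le> M * (\<Sum>l\<in>{l. h l > h i}. cmod (u (Suc n) $ l) + cmod (u n $ l))"
        unfolding sum_distrib_left norm_mult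
        by (intro sum_mono mult_mono M) (use M0 in auto)
      finally show ?thesis by simp
    qed
    have "cmod (u n $ i) \<le> K i * r ^ n * (\<Sum>l\<in>UNIV. cmod (u 0 $ l))" for i
      using K(2)[of "\<lambda>n i. cmod (u n $ i)" n i] step by (simp add: rec_def)
    then have "norm (u n) \<le> (\<Sum>i\<in>UNIV. K i * r ^ n * (\<Sum>l\<in>UNIV. cmod (u 0 $ l)))"
      unfolding norm_vec_def by (intro order_trans[OF L2_set_le_sum] sum_mono) auto
    also have "\<dots> = (\<Sum>i\<in>UNIV. K i) * r ^ n * (\<Sum>l\<in>UNIV. cmod (u 0 $ l))"
      by (simp add: sum_distrib_right)
    also have "\<dots> \<le> (\<Sum>i\<in>UNIV. K i) * r ^ n * (CARD('n) * (L * norm x))"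
    proof (intro mult_left_mono)
      show "(\<Sum>l\<in>UNIV. cmod (u 0 $ l)) \<le> CARD('n) * (L * norm x)"
        using sum_bounded_above[of "UNIV :: 'n set" "\<lambda>l. cmod (u 0 $ l)" "L * norm x"] L(2)
        by (simp add: u_def)
    qed (use K(1) r in \<open>auto intro!: sum_nonneg mult_nonneg_nonneg\<close>)
    finally have le: "norm (u n) \<le> (\<Sum>i\<in>UNIV. K i) * r ^ n * (CARD('n) * (L * norm x))" .
    have "norm ((((*v) V) ^^ n) x) = norm (P *v u n)"
      by (simp add: P_u norm_cvec)
    also have "\<dots> \<le> norm (u n) * L'"
      by (rule L')
    also have "\<dots> \<le> (\<Sum>i\<in>UNIV. K i) * r ^ n * (CARD('n) * (L * norm x)) * L'"
      using le L' by (intro mult_right_mono) auto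
    finally show ?thesis by (simp add: algebra_simps)
  qed
  show thesis
    using that[OF r(1,2)] bound V_def by blast
qed

text \<open>The determinant is additive in each row, so one of the two real determinants obtained by
  replacing a row by its real or its imaginary part does not vanish either.\<close>
lemma real_or_imaginary_rows:
  fixes Q :: "complex^'n^'n"
  assumes "det Q \<noteq> 0"
  obtains T :: "real^'n^'n" where "det T \<noteq> 0"
    "\<And>i. T$i = (\<chi> j. Re (Q$i$j)) \<or> T$i = (\<chi> j. Im (Q$i$j))"
proof -
  \<comment> \<open>The rows are replaced one at a time: \<open>S\<close> is the set of rows already
    made real, the others being still those of \<open>Q\<close>.\<close>
  have "\<exists>T :: real^'n^'n. det (\<chi> i. if i \<in> S then cvec (T$i) else Q$i) \<noteq> 0 \<and>
    (\<forall>i. T$i = (\<chi> j. Re (Q$i$j)) \<or> T$i = (\<chi> j. Im (Q$i$j)))" if "finite S" for S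
    using that
  proof (induction S rule: finite_induct)
    case empty
    then show ?case
      using assms by (intro exI[of _ "\<chi> i j. Re (Q$i$j)"]) auto
  next
    case (insert k S)
    then obtain T :: "real^'n^'n" where T: "det (\<chi> i. if i \<in> S then cvec (T$i) else Q$i) \<noteq> 0"
      "\<And>i. T$i = (\<chi> j. Re (Q$i$j)) \<or> T$i = (\<chi> j. Im (Q$i$j))" by auto
    define R where "R i = (if i \<in> S then cvec (T$i) else Q$i)" for i
    define a where "a = (\<chi> j. Re (Q$k$j))"
    define b where "b = (\<chi> j. Im (Q$k$j))"
    have "R = (\<lambda>i. if i = k then cvec a + \<i> *s cvec b else R i)"
      using insert(2) by (auto simp: R_def a_def b_def vec_eq_iff complex_eq fun_eq_iff)
    then have "det (\<chi> i. R i) = det (\<chi> i. if i = k then cvec a + \<i> *s cvec b else R i)"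
      by metis
    also have "\<dots> = det (\<chi> i. if i = k then cvec a else R i) + \<i> * det (\<chi> i. if i = k then cvec b else R i)"
      by (simp only: det_row_add det_row_mul)
    finally have "det (\<chi> i. if i = k then cvec a else R i) \<noteq> 0 \<or> det (\<chi> i. if i = k then cvec b else R i) \<noteq> 0"
      using T(1) by (auto simp: R_def)
    then obtain e where e: "e = a \<or> e = b" "det (\<chi> i. if i = k then cvec e else R i) \<noteq> 0"
      by auto
    define T' where "T' = (\<chi> i. if i = k then e else T$i)"
    have "(\<chi> i. if i \<in> insert k S then cvec (T'$i) else Q$i) = (\<chi> i. if i = k then cvec e else R i)"
      by (auto simp: T'_def R_def vec_eq_iff)
    then show ?case
      using T(2) e by (intro exI[of _ T']) (auto simp: T'_def a_def b_def)
  qed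
  from this[of UNIV] obtain T :: "real^'n^'n" where T: "det (\<chi> i. cvec (T$i)) \<noteq> 0"
    "\<And>i. T$i = (\<chi> j. Re (Q$i$j)) \<or> T$i = (\<chi> j. Im (Q$i$j))" by auto
  have "(\<chi> i. cvec (T$i)) = cmat T"
    by (simp add: cmat_def map_matrix_def)
  then show thesis
    using T by (intro that[of T]) (auto simp: det_cmat)
qed

text \<open>The lower bounds on the iterates of \<open>V\<close> are upper bounds on the iterates of
  its inverse. Starting from \<open>V\<close> applied \<open>n\<close> times to \<open>x\<close>,
  each backward step expands the triangular coordinate \<open>i\<close> by at most
  \<open>c powr (- \<kappa> i)\<close>, apart from contributions of later rows. The loss
  \<open>\<epsilon>\<close> absorbs these contributions. The rows of \<open>T\<close> are real or
  imaginary parts of the rows of \<open>Q\<close>, so the bounds for the complex coordinates pass to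
  real ones.\<close>

lemma mat_powr_expansion_coordinates:
  fixes D :: "real^'n^'n"
  assumes inv: "invertible (mat_powr c D)" and c: "0 < c" "c < 1"
  obtains T :: "real^'n^'n" and \<kappa> :: "'n \<Rightarrow> real" where
    "det T \<noteq> 0" "\<And>r. card {i. \<kappa> i = r} = re_multiplicity D r"
    "range \<kappa> = Re ` {z. ceigenvalue D z}"
    "\<And>\<epsilon>. \<epsilon> > 0 \<Longrightarrow> \<exists>K>0. \<forall>n x i.
       \<bar>(T *v x)$i\<bar> \<le> K * c powr (- (real n * (\<kappa> i + \<epsilon>))) * norm ((((*v) (mat_powr c D)) ^^ n) x)"
proof -
  obtain P Q B :: "complex^'n^'n" and h :: "'n \<Rightarrow> nat" where
    PQ: "P ** Q = mat 1" "Q ** P = mat 1" and A: "cmat D = P ** B ** Q" and h: "inj h" "upper_tri h B"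
    and sorted: "\<And>i j. h i \<le> h j \<Longrightarrow> Re (B$j$j) \<le> Re (B$i$i)"
    using complex_triangularization[of "cmat D"] by metis
  define \<kappa> where "\<kappa> i = Re (B$i$i)" for i
  have "det Q * det P = 1"
    using PQ(2) by (metis det_I det_mul)
  then have "det Q \<noteq> 0" by auto
  then obtain T :: "real^'n^'n" where T: "det T \<noteq> 0"
    "\<And>i. T$i = (\<chi> j. Re (Q$i$j)) \<or> T$i = (\<chi> j. Im (Q$i$j))"
    using real_or_imaginary_rows by blast
  have T_le: "\<bar>(T *v x)$i\<bar> \<le> cmod ((Q *v cvec x)$i)" for x i
    using T(2)[of i] abs_Re_le_cmod[of "(Q *v cvec x)$i"] abs_Im_le_cmod[of "(Q *v cvec x)$i"]
    by (auto simp: matrix_vector_mult_def)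
  define V where "V = mat_powr c D"
  obtain W where "V ** W = mat 1" "W ** V = mat 1"
    using inv by (auto simp: V_def invertible_def)
  then have VW: "V *v (W *v x) = x" "W *v (V *v x) = x" for x
    by (simp_all add: matrix_vector_mul_assoc)
  define G where "G = Q ** cmat V ** P"
  have G: "upper_tri h G" "\<And>i. G$i$i = exp (complex_of_real (ln c) * B$i$i)"
    unfolding G_def V_def by (rule mat_powr_triangular[OF A PQ(2) h(2,1)])+
  define \<rho> where "\<rho> i = c powr (- \<kappa> i)" for i
  have \<rho>: "\<rho> i > 0" "cmod (G$i$i) = 1 / \<rho> i" for i
    using c by (simp_all add: \<rho>_def G(2) powr_minus powr_def \<kappa>_def divide_simps mult.commute mult_exp_exp)
  define M0 where "M0 = Max (range (\<lambda>(i, j). cmod (G$i$j)))"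
  have M0: "cmod (G$i$j) \<le> M0" for i j
    unfolding M0_def by (intro Max_ge) (auto intro!: image_eqI[of _ _ "(i, j)"])
  have M0_nn: "M0 \<ge> 0"
    using M0 norm_ge_zero order_trans by blast
  define M where "M = Max (range \<rho>) * M0"
  have M: "\<rho> i * M0 \<le> M" for i
    unfolding M_def using M0_nn by (intro mult_right_mono Max_ge) auto
  have M_nn: "M \<ge> 0"
    using M[of undefined] M0_nn \<rho>(1)[of undefined] by (meson mult_nonneg_nonneg order_trans less_imp_le)
  obtain L where L: "L > 0" "\<And>x i. norm ((Q *v cvec x)$i) \<le> L * norm x"
    using norm_mult_cvec_le[of Q] by blast
  have bound: "\<exists>K>0. \<forall>n x i.
     \<bar>(T *v x)$i\<bar> \<le> K * c powr (- (real n * (\<kappa> i + \<epsilon>))) * norm ((((*v) V) ^^ n) x)" if "\<epsilon> > 0" for \<epsilon>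
  proof -
    define r where "r i = c powr (- (\<kappa> i + \<epsilon>))" for i
    have r: "r i > 0" for i
      using c by (simp add: r_def)
    \<comment> \<open>The ordering of the diagonal enters here: later rows have smaller or equal
      real parts, hence smaller or equal rates because \<open>c < 1\<close>.\<close>
    have less: "\<rho> k < r i" if "h k \<ge> h i" for i k
      using sorted[OF that] \<open>\<epsilon> > 0\<close> c
      by (auto simp: \<rho>_def r_def \<kappa>_def intro!: powr_less_mono')
    define rec where "rec u \<longleftrightarrow> (\<forall>n i. 0 \<le> u n i) \<and>
       (\<forall>n i. u (Suc n) i \<le> \<rho> i * u n i + M * (\<Sum>l\<in>{l. h l > h i}. u (Suc n) l + u n l))"
      for u :: "nat \<Rightarrow> 'n \<Rightarrow> real"
    have "\<forall>i. \<exists>K. K \<ge> 0 \<and> (\<forall>u n. rec u \<longrightarrow> u n i \<le> K * r i ^ n * (\<Sum>l\<in>UNIV. u 0 l))"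
    proof
      fix i
      have "\<exists>K\<ge>0. \<forall>u :: nat \<Rightarrow> 'n \<Rightarrow> real. (\<forall>n i. 0 \<le> u n i) \<longrightarrow>
       (\<forall>n i. u (Suc n) i \<le> \<rho> i * u n i + M * (\<Sum>l\<in>{l. h l > h i}. u (Suc n) l + u n l)) \<longrightarrow>
       (\<forall>n. u n i \<le> K * r i ^ n * (\<Sum>l\<in>UNIV. u 0 l))"
        by (rule triangular_recursion_growth) (use M_nn r \<rho>(1) less in \<open>auto intro: less_imp_le\<close>)
      then show "\<exists>K. K \<ge> 0 \<and> (\<forall>u n. rec u \<longrightarrow> u n i \<le> K * r i ^ n * (\<Sum>l\<in>UNIV. u 0 l))"
        unfolding rec_def by blast
    qed
    from choice[OF this] obtain K where K: "\<And>i. K i \<ge> 0"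
      "\<And>i u n. rec u \<Longrightarrow> u n i \<le> K i * r i ^ n * (\<Sum>l\<in>UNIV. u 0 l)"
      by blast
    \<comment> \<open>The summand 1 keeps \<open>K'\<close> positive even when all
      \<open>K i\<close> vanish.\<close>
    define K' where "K' = (1 + (\<Sum>i\<in>UNIV. K i)) * (CARD('n) * L)"
    have "K' > 0"
      unfolding K'_def using L(1) K(1) by (auto intro!: mult_pos_pos add_pos_nonneg sum_nonneg)
    moreover have "\<bar>(T *v x)$i\<bar> \<le> K' * c powr (- (real n * (\<kappa> i + \<epsilon>))) * norm ((((*v) V) ^^ n) x)" for n x i
    proof -
      define y where "y = (((*v) V) ^^ n) x"
      \<comment> \<open>The orbit runs backwards from \<open>y\<close>, reaching \<open>x\<close>
        after \<open>n\<close> steps; hence \<open>u k = G *v u (Suc k)\<close>, the inverse form of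
        the recursion.\<close>
      define u where "u k = Q *v cvec ((((*v) W) ^^ k) y)" for k
      have W_y: "(((*v) W) ^^ n) y = x"
        unfolding y_def
      proof (induction n)
        case (Suc n)
        have "(((*v) W) ^^ Suc n) ((((*v) V) ^^ Suc n) x) = (((*v) W) ^^ n) (W *v (V *v (((*v) V) ^^ n) x))"
          by (simp only: funpow_Suc_right[of n "(*v) W"] o_apply funpow.simps(2)[of n "(*v) V"])
        then show ?case
          using Suc by (simp only: VW)
      qed simp
      have P_u: "P *v u n = cvec ((((*v) W) ^^ n) y)" for n
        by (simp add: u_def matrix_vector_mul_assoc PQ(1))
      have u_Suc: "u k = G *v u (Suc k)" for k
      proof -
        have "G *v u (Suc k) = Q *v (cmat V *v (P *v u (Suc k)))"
          by (simp add: G_def matrix_vector_mul_assoc matrix_mul_assoc)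
        also have "\<dots> = u k"
          unfolding P_u by (simp add: u_def cmat_mult_cvec VW)
        finally show ?thesis by simp
      qed
      have step: "cmod (u (Suc k) $ i) \<le> \<rho> i * cmod (u k $ i)
         + M * (\<Sum>l\<in>{l. h l > h i}. cmod (u (Suc k) $ l) + cmod (u k $ l))" for k i
      proof -
        have "u k $ i = (\<Sum>l\<in>UNIV. G$i$l * u (Suc k) $ l)"
          unfolding u_Suc[of k] by (simp add: matrix_vector_mult_def)
        also have "\<dots> = (\<Sum>l\<in>insert i {l. h l > h i}. G$i$l * u (Suc k) $ l)"
        proof (intro sum.mono_neutral_right ballI)
          fix l assume "l \<in> UNIV - insert i {l. h l > h i}"
          then have "h l < h i"
            using h(1) by (auto simp: not_less le_less inj_eq)
          then show "G$i$l * u (Suc k) $ l = 0"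
            using G(1) by (simp add: upper_tri_def)
        qed auto
        also have "\<dots> = G$i$i * u (Suc k) $ i + (\<Sum>l\<in>{l. h l > h i}. G$i$l * u (Suc k) $ l)"
          by (subst sum.insert) auto
        finally have "G$i$i * u (Suc k) $ i = u k $ i - (\<Sum>l\<in>{l. h l > h i}. G$i$l * u (Suc k) $ l)"
          by simp
        then have "cmod (G$i$i) * cmod (u (Suc k) $ i) = cmod (u k $ i - (\<Sum>l\<in>{l. h l > h i}. G$i$l * u (Suc k) $ l))"
          by (metis norm_mult)
        also have "\<dots> \<le> cmod (u k $ i) + (\<Sum>l\<in>{l. h l > h i}. cmod (G$i$l * u (Suc k) $ l))"
          by (intro order_trans[OF norm_triangle_ineq4] add_mono norm_sum order_refl)
        also have "(\<Sum>l\<in>{l. h l > h i}. cmod (G$i$l * u (Suc k) $ l)) \<le> M0 * (\<Sum>l\<in>{l. h l > h i}. cmod (u (Suc k) $ l) + cmod (u k $ l))"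
          unfolding sum_distrib_left norm_mult
          by (intro sum_mono mult_mono M0) (use M0_nn in auto)
        finally have "cmod (u (Suc k) $ i) / \<rho> i \<le> cmod (u k $ i) + M0 * (\<Sum>l\<in>{l. h l > h i}. cmod (u (Suc k) $ l) + cmod (u k $ l))"
          by (simp add: \<rho>(2))
        then have "cmod (u (Suc k) $ i) \<le> \<rho> i * cmod (u k $ i) + (\<rho> i * M0) * (\<Sum>l\<in>{l. h l > h i}. cmod (u (Suc k) $ l) + cmod (u k $ l))"
          using \<rho>(1)[of i] by (simp add: divide_le_eq algebra_simps)
        also have "\<dots> \<le> \<rho> i * cmod (u k $ i) + M * (\<Sum>l\<in>{l. h l > h i}. cmod (u (Suc k) $ l) + cmod (u k $ l))"
          by (intro add_left_mono mult_right_mono M sum_nonneg) auto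
        finally show ?thesis .
      qed
      have "\<bar>(T *v x)$i\<bar> \<le> cmod (u n $ i)"
        using T_le[of x i] by (simp add: u_def W_y)
      also have "\<dots> \<le> K i * r i ^ n * (\<Sum>l\<in>UNIV. cmod (u 0 $ l))"
        using K(2)[of "\<lambda>n i. cmod (u n $ i)" n i] step by (simp add: rec_def)
      also have "\<dots> \<le> (1 + (\<Sum>i\<in>UNIV. K i)) * r i ^ n * (CARD('n) * (L * norm y))"
      proof (intro mult_mono)
        show "(\<Sum>l\<in>UNIV. cmod (u 0 $ l)) \<le> CARD('n) * (L * norm y)"
          using sum_bounded_above[of "UNIV :: 'n set" "\<lambda>l. cmod (u 0 $ l)" "L * norm y"] L(2)
          by (simp add: u_def)
        show "K i \<le> 1 + (\<Sum>i\<in>UNIV. K i)"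
          using member_le_sum[of i UNIV K] K(1) by simp
      qed (use K(1) r[of i] in \<open>auto intro!: add_nonneg_nonneg sum_nonneg mult_nonneg_nonneg\<close>)
      also have "r i ^ n = c powr (- (real n * (\<kappa> i + \<epsilon>)))"
        using c r[of i] by (simp add: r_def powr_realpow[symmetric] powr_powr algebra_simps)
      finally show ?thesis
        by (simp add: K'_def y_def algebra_simps)
    qed
    ultimately show ?thesis by blast
  qed
  show thesis
  proof (rule that[OF T(1), of \<kappa>])
    show "card {i. \<kappa> i = r} = re_multiplicity D r" for r
      by (simp add: \<kappa>_def re_multiplicity_triangular[OF A PQ(1) h(2,1)])
    show "range \<kappa> = Re ` {z. ceigenvalue D z}"
      by (auto simp: \<kappa>_def ceigenvalue_triangular[OF A PQ(1) h(2,1)])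
  qed (use bound V_def in auto)
qed

section \<open>The exponents \<open>\<eta>\<close>\<close>

lemma sum_by_value:
  fixes \<kappa> :: "'m::finite \<Rightarrow> real" and f :: "real \<Rightarrow> real"
  assumes "inj_on lam I" "range \<kappa> = lam ` I" "\<And>i. i \<in> I \<Longrightarrow> mu i = card {j. \<kappa> j = lam i}"
  shows "(\<Sum>j\<in>UNIV. f (\<kappa> j)) = (\<Sum>i\<in>I. f (lam i) * real (mu i))"
proof -
  have "(\<Sum>j\<in>UNIV. f (\<kappa> j)) = (\<Sum>y\<in>range \<kappa>. \<Sum>j\<in>{j \<in> UNIV. \<kappa> j = y}. f (\<kappa> j))"
    by (rule sum.image_gen) simp
  also have "\<dots> = (\<Sum>y\<in>lam ` I. f y * real (card {j. \<kappa> j = y}))"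
    unfolding assms(2) by (intro sum.cong refl) (simp add: mult.commute)
  also have "\<dots> = (\<Sum>i\<in>I. f (lam i) * real (mu i))"
    by (subst sum.reindex[OF assms(1)]) (simp add: assms(3))
  finally show ?thesis .
qed

text \<open>The budget \<open>q\<close> is spent greedily on the smallest costs
  \<open>\<kappa> j\<close>: full weight below the critical level \<open>lam l\<close>, a fraction
  \<open>t\<close> on that level, nothing above. The total weight is then the formula for
  \<open>sdim\<close>. Without a critical level the budget pays for full weight everywhere, which
  gives \<open>CARD('m)\<close>.\<close>

lemma sdim_weights_aux:
  fixes \<kappa> :: "'m::finite \<Rightarrow> real"
  assumes mono: "strict_mono_on {1..p} lam" and range: "range \<kappa> = lam ` {1..p}"
    and mu: "\<And>i. i \<in> {1..p} \<Longrightarrow> mu i = card {j. \<kappa> j = lam i}"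
    and pos: "\<And>j. \<kappa> j > 0" and q: "0 < q"
  obtains \<theta> :: "'m \<Rightarrow> real" where "\<And>j. 0 \<le> \<theta> j" "\<And>j. \<theta> j \<le> 1"
    "(\<Sum>j\<in>UNIV. \<theta> j) = sdim CARD('m) lam mu p q" "(\<Sum>j\<in>UNIV. \<kappa> j * \<theta> j) \<le> q"
proof -
  have inj: "inj_on lam {1..p}"
    using mono by (rule strict_mono_on_imp_inj_on)
  note sum_eq = sum_by_value[OF inj range mu]
  have lam_pos: "lam i > 0" if "i \<in> {1..p}" for i
    using range pos that by (metis imageI rangeE)
  define S where "S l = (\<Sum>i = 1..l. lam i * real (mu i))" for l
  have S_mono: "S l \<le> S l'" if "l \<le> l'" "l' \<le> p" for l l'
    unfolding S_def
  proof (intro sum_mono2)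
    fix i assume "i \<in> {1..l'} - {1..l}"
    then show "0 \<le> lam i * real (mu i)"
      using that lam_pos[of i] by auto
  qed (use that in auto)
  have idx: "sdim_index lam mu p q l \<longleftrightarrow> l \<in> {1..p} \<and> S (l - 1) < q \<and> q \<le> S l" for l
    by (simp add: sdim_index_def S_def)
  show thesis
  proof (cases "\<exists>l. sdim_index lam mu p q l")
    case True
    then obtain l where l: "sdim_index lam mu p q l" by blast
    have uniq: "l' = l''" if "sdim_index lam mu p q l'" "sdim_index lam mu p q l''" for l' l''
    proof (rule ccontr)
      have *: False if "sdim_index lam mu p q a" "sdim_index lam mu p q b" "a < b" for a b
      proof -
        have "a \<le> b - 1" "b - 1 \<le> p"
          using that by (auto simp: idx)
        then show False
          using S_mono[of a "b - 1"] that by (auto simp: idx)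
      qed
      assume "l' \<noteq> l''"
      then show False
        using *[of l' l''] *[of l'' l'] that by (metis linorder_neqE_nat)
    qed
    have the: "(THE l. sdim_index lam mu p q l) = l"
      using l uniq by blast
    have lp: "l \<in> {1..p}" and Sl: "S (l - 1) < q" "q \<le> S l"
      using l by (auto simp: idx)
    \<comment> \<open>The levels below \<open>l\<close> cost \<open>S (l - 1)\<close>;
      \<open>t\<close> is the share of level \<open>l\<close> that the rest of the budget pays
      for.\<close>
    define t where "t = (q - S (l - 1)) / (lam l * real (mu l))"
    have "lam l \<in> range \<kappa>"
      using lp range by simp
    then obtain j where "\<kappa> j = lam l" by auto
    then have "mu l > 0"
      using mu[OF lp] by (auto simp: card_gt_0_iff)
    then have den: "lam l * real (mu l) > 0"
      using lam_pos[OF lp] by simp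
    have S_step: "S l = S (l - 1) + lam l * real (mu l)"
      using lp by (cases l) (simp_all add: S_def)
    have t: "0 \<le> t" "t \<le> 1"
      using Sl den unfolding t_def by (simp_all add: S_step divide_le_eq)
    have t_eq: "t * (lam l * real (mu l)) = q - S (l - 1)"
      using den \<open>mu l > 0\<close> lam_pos[OF lp] by (simp add: t_def)
    define w where "w x = (if x < lam l then 1 else if x = lam l then t else 0)" for x
    have split: "{1..p} = {1..l - 1} \<union> ({l} \<union> {l + 1..p})"
      using lp by auto
    have lt: "lam i < lam l" if "i \<in> {1..l - 1}" for i
      using that lp by (intro strict_mono_onD[OF mono]) auto
    have gt: "lam l < lam i" if "i \<in> {l + 1..p}" for i
      using that lp by (intro strict_mono_onD[OF mono]) auto
    have sum_w: "(\<Sum>i\<in>{1..p}. g i * w (lam i) * real (mu i))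
      = (\<Sum>i = 1..l - 1. g i * real (mu i)) + g l * t * real (mu l)" for g
    proof -
      have "(\<Sum>i\<in>{1..p}. g i * w (lam i) * real (mu i))
        = (\<Sum>i = 1..l - 1. g i * w (lam i) * real (mu i)) + (g l * w (lam l) * real (mu l)
          + (\<Sum>i\<in>{l + 1..p}. g i * w (lam i) * real (mu i)))"
        unfolding split using lp by (subst sum.union_disjoint; auto)+
      also have "(\<Sum>i\<in>{l + 1..p}. g i * w (lam i) * real (mu i)) = 0"
        using gt by (intro sum.neutral) (force simp: w_def)
      also have "(\<Sum>i = 1..l - 1. g i * w (lam i) * real (mu i)) = (\<Sum>i = 1..l - 1. g i * real (mu i))"
        using lt by (intro sum.cong) (auto simp: w_def)
      finally show ?thesis by (simp add: w_def)
    qed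
    show thesis
    proof (rule that[of "\<lambda>j. w (\<kappa> j)"])
      show "0 \<le> w (\<kappa> j)" "w (\<kappa> j) \<le> 1" for j
        using t by (auto simp: w_def)
      have "(\<Sum>j\<in>UNIV. \<kappa> j * w (\<kappa> j)) = S (l - 1) + lam l * t * real (mu l)"
        using sum_eq[of "\<lambda>x. x * w x"] sum_w[of lam] by (simp add: S_def)
      then show "(\<Sum>j\<in>UNIV. \<kappa> j * w (\<kappa> j)) \<le> q"
        using t_eq by (simp add: mult_ac)
      have "(\<Sum>i = 1..l. (lam l - lam i) * real (mu i)) = (\<Sum>i = 1..l - 1. (lam l - lam i) * real (mu i))"
        using lp by (cases l) simp_all
      also have "\<dots> = lam l * (\<Sum>i = 1..l - 1. real (mu i)) - S (l - 1)"
        by (simp add: S_def left_diff_distrib sum_subtractf sum_distrib_left)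
      finally have "sdim CARD('m) lam mu p q
        = 1 / lam l * (q + (lam l * (\<Sum>i = 1..l - 1. real (mu i)) - S (l - 1)))"
        using True by (simp add: sdim_def the Let_def)
      also have "\<dots> = (\<Sum>i = 1..l - 1. real (mu i)) + t * real (mu l)"
        using t_eq lam_pos[OF lp] by (simp add: field_simps)
      also have "\<dots> = (\<Sum>j\<in>UNIV. w (\<kappa> j))"
        using sum_eq[of w] sum_w[of "\<lambda>_. 1"] by simp
      finally show "(\<Sum>j\<in>UNIV. w (\<kappa> j)) = sdim CARD('m) lam mu p q" ..
    qed
  next
    case False
    have "S p \<le> q"
    proof (rule ccontr)
      assume "\<not> S p \<le> q"
      then have ex: "\<exists>l. q \<le> S l" by (intro exI[of _ p]) simp
      \<comment> \<open>If the budget did not suffice for all levels, the first \<open>l\<close>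
        with \<open>q \<le> S l\<close> would be a critical index. It is not 0 because
        \<open>S 0 = 0 < q\<close>.\<close>
      define l where "l = (LEAST l. q \<le> S l)"
      have l: "q \<le> S l" "l \<le> p"
        using \<open>\<not> S p \<le> q\<close> LeastI_ex[OF ex] by (auto simp: l_def intro: Least_le)
      have "l \<noteq> 0"
        using l(1) q by (cases l) (auto simp: S_def)
      then have "\<not> q \<le> S (l - 1)"
        unfolding l_def by (intro not_less_Least) (simp flip: l_def)
      then show False
        using False l \<open>l \<noteq> 0\<close> by (auto simp: idx not_le)
    qed
    then show thesis
      using False sum_eq[of "\<lambda>x. x"]
      by (intro that[of "\<lambda>_. 1"]) (auto simp: sdim_def S_def)
  qed
qed

text \<open>Shrinking the greedy weights by the factor \<open>\<gamma> / s < 1\<close> makes both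
  estimates strict. Weights below 1 are what local integrability of the one-dimensional kernels
  requires, and total cost below \<open>q\<close> is what makes the later geometric series
  converge.\<close>

lemma sdim_weights:
  fixes \<kappa> :: "'m::finite \<Rightarrow> real"
  assumes "strict_mono_on {1..p} lam" and "range \<kappa> = lam ` {1..p}"
    and "\<And>i. i \<in> {1..p} \<Longrightarrow> mu i = card {j. \<kappa> j = lam i}"
    and pos: "\<And>j. \<kappa> j > 0" and q: "0 < q"
    and \<gamma>: "0 \<le> \<gamma>" "\<gamma> < sdim CARD('m) lam mu p q"
  obtains \<eta> :: "'m \<Rightarrow> real" where "\<And>j. 0 \<le> \<eta> j" "\<And>j. \<eta> j < 1"
    "(\<Sum>j\<in>UNIV. \<eta> j) = \<gamma>" "(\<Sum>j\<in>UNIV. \<kappa> j * \<eta> j) < q"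
proof -
  define s where "s = sdim CARD('m) lam mu p q"
  obtain \<theta> :: "'m \<Rightarrow> real" where \<theta>: "\<And>j. 0 \<le> \<theta> j" "\<And>j. \<theta> j \<le> 1"
    "(\<Sum>j\<in>UNIV. \<theta> j) = s" "(\<Sum>j\<in>UNIV. \<kappa> j * \<theta> j) \<le> q"
    using sdim_weights_aux[OF assms(1-5)] unfolding s_def by metis
  have a: "0 \<le> \<gamma> / s" "\<gamma> / s < 1" and s: "s > 0"
    using \<gamma> by (auto simp: s_def divide_simps)
  show thesis
  proof (rule that[of "\<lambda>j. \<gamma> / s * \<theta> j"])
    show "0 \<le> \<gamma> / s * \<theta> j" for j
      using a \<theta>(1) by (intro mult_nonneg_nonneg)
    show "\<gamma> / s * \<theta> j < 1" for j
      using mult_left_mono[OF \<theta>(2)[of j] a(1)] a(2) by simp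
    show "(\<Sum>j\<in>UNIV. \<gamma> / s * \<theta> j) = \<gamma>"
      unfolding sum_distrib_left[symmetric] \<theta>(3) using s by simp
    have "(\<Sum>j\<in>UNIV. \<kappa> j * (\<gamma> / s * \<theta> j)) = \<gamma> / s * (\<Sum>j\<in>UNIV. \<kappa> j * \<theta> j)"
      by (simp add: sum_distrib_left mult_ac)
    also have "\<dots> \<le> \<gamma> / s * q"
      using \<theta>(4) a by (intro mult_left_mono)
    also have "\<dots> < q"
      using mult_strict_right_mono[OF a(2) q] by simp
    finally show "(\<Sum>j\<in>UNIV. \<kappa> j * (\<gamma> / s * \<theta> j)) < q" .
  qed
qed

section \<open>Riesz kernels and linear changes of variables\<close>

text \<open>The value at \<open>0\<close> cannot be left to \<open>powr\<close>, for which \<open>0 powr (- \<gamma>) = 0\<close>.\<close>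
definition riesz :: "real \<Rightarrow> 'a::real_normed_vector \<Rightarrow> ennreal" where
  "riesz \<gamma> x = (if x = 0 then \<top> else ennreal (norm x powr (- \<gamma>)))"

lemma borel_measurable_riesz [measurable]:
  "riesz \<gamma> \<in> borel_measurable (borel :: 'a::euclidean_space measure)"
  unfolding riesz_def by measurable

lemma riesz_neq_0: "riesz \<gamma> x \<noteq> 0"
  by (auto simp: riesz_def)

text \<open>The value \<open>\<top>\<close> at 0 is carried by a null set; away from it the integral
  splits into two half-lines, related by reflection, on which \<open>\<eta> < 1\<close> gives
  convergence.\<close>

lemma nn_integral_riesz_finite:
  assumes "0 \<le> \<eta>" "\<eta> < 1" "0 \<le> R"
  shows "(\<integral>\<^sup>+y. indicator {- R..R} y * riesz \<eta> (y::real) \<partial>lborel) < \<top>"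
proof -
  define f where "f y = (if y \<in> {0..R} then y powr (- \<eta>) else 0)" for y :: real
  have [measurable]: "f \<in> borel_measurable borel"
    unfolding f_def by measurable
  have f: "(\<integral>\<^sup>+y. ennreal (f y) \<partial>lborel) < \<top>"
  proof -
    have "(f has_integral (R powr (- \<eta> + 1) / (- \<eta> + 1))) UNIV"
      using has_integral_powr_from_0[of "- \<eta>" R] assms
      unfolding f_def has_integral_restrict_UNIV by simp
    then have "(\<integral>\<^sup>+y. ennreal (f y) \<partial>lborel) = ennreal (R powr (- \<eta> + 1) / (- \<eta> + 1))"
      by (intro nn_integral_has_integral_lborel) (simp_all add: f_def[abs_def, symmetric], simp add: f_def)
    then show ?thesis by simp
  qed
  have f': "(\<integral>\<^sup>+y. ennreal (f (- y)) \<partial>lborel) < \<top>"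
    using f nn_integral_real_affine[of "\<lambda>y. ennreal (f y)" "-1" 0] by simp
  have "(\<integral>\<^sup>+y. indicator {- R..R} y * riesz \<eta> y \<partial>lborel) \<le> (\<integral>\<^sup>+y. ennreal (f y) + ennreal (f (- y)) \<partial>lborel)"
  proof (intro nn_integral_mono_AE)
    have "AE y in lborel. y \<noteq> (0::real)"
      by (rule AE_lborel_singleton)
    then show "AE y in lborel. indicator {- R..R} y * riesz \<eta> y \<le> ennreal (f y) + ennreal (f (- y))"
      by eventually_elim (auto simp: indicator_def f_def riesz_def split: if_splits)
  qed
  also have "\<dots> = (\<integral>\<^sup>+y. ennreal (f y) \<partial>lborel) + (\<integral>\<^sup>+y. ennreal (f (- y)) \<partial>lborel)"
    by (rule nn_integral_add) auto
  also have "\<dots> < \<top>"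
    using f f' by simp
  finally show ?thesis .
qed

lemma prod_Basis_cart:
  "(\<Prod>b\<in>Basis. f b) = (\<Prod>j\<in>UNIV. f (axis j 1 :: real^'n))"
proof -
  have inj: "inj (\<lambda>j. axis j 1 :: real^'n)"
    by (auto simp: inj_on_def axis_eq_axis)
  have Basis: "Basis = range (\<lambda>j. axis j 1 :: real^'n)"
    by (auto simp: Basis_vec_def)
  show ?thesis
    unfolding Basis prod.reindex[OF inj] by simp
qed

lemma nn_integral_lborel_prod_cart:
  fixes F :: "'n::finite \<Rightarrow> real \<Rightarrow> ennreal"
  assumes [measurable]: "\<And>j. F j \<in> borel_measurable borel"
  shows "(\<integral>\<^sup>+x. (\<Prod>j\<in>UNIV. F j (x $ j)) \<partial>(lborel :: (real^'n) measure)) = (\<Prod>j\<in>UNIV. \<integral>\<^sup>+y. F j y \<partial>lborel)"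
proof -
  define e :: "'n \<Rightarrow> real^'n" where "e j = axis j 1" for j
  define f where "f b = F (inv_into UNIV e b)" for b
  have inj: "inj e"
    by (auto simp: e_def inj_on_def axis_eq_axis)
  have Basis: "Basis = range e"
    by (auto simp: Basis_vec_def e_def)
  have f: "f (e j) = F j" for j
    by (simp add: f_def inj)
  have "(\<integral>\<^sup>+x. (\<Prod>b\<in>Basis. f b (x \<bullet> b)) \<partial>(lborel :: (real^'n) measure)) = (\<Prod>b\<in>Basis. \<integral>\<^sup>+y. f b y \<partial>lborel)"
    by (rule nn_integral_lborel_prod) (auto simp: f_def)
  then show ?thesis
    unfolding Basis by (simp add: prod.reindex[OF inj] f) (simp add: e_def inner_axis)
qed

section \<open>Translations, shears and general linear substitutions\<close>

lemma nn_integral_lborel_translation: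
  assumes [measurable]: "f \<in> borel_measurable borel"
  shows "(\<integral>\<^sup>+x. f (x + a) \<partial>lborel) = (\<integral>\<^sup>+x. f x \<partial>(lborel :: 'a::euclidean_space measure))"
proof -
  have "(\<integral>\<^sup>+x. f x \<partial>lborel) = (\<integral>\<^sup>+x. f x \<partial>distr lborel borel ((+) a))"
    by (simp add: lborel_distr_plus)
  then show ?thesis
    by (simp add: nn_integral_distr add.commute)
qed

text \<open>Averaging over all translates in direction \<open>e\<close> replaces the variable amount of shift \<open>\<phi> x\<close> by
  a translation of the real line.\<close>
lemma nn_integral_lborel_shear:
  fixes f :: "'a::euclidean_space \<Rightarrow> ennreal" and \<phi> :: "'a \<Rightarrow> real"
  assumes f: "f \<in> borel_measurable borel" and \<phi>: "\<phi> \<in> borel_measurable borel"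
    and inv: "\<And>x s. \<phi> (x + s *\<^sub>R e) = \<phi> x" and e: "e \<bullet> e = 1"
  shows "(\<integral>\<^sup>+x. f (x + \<phi> x *\<^sub>R e) \<partial>lborel) = (\<integral>\<^sup>+x. f x \<partial>lborel)"
proof -
  note [measurable] = f
  \<comment> \<open>All translates of this weight have integral 1, so it can be inserted under the
    integral with a shift depending on \<open>x\<close>.\<close>
  define w :: "real \<Rightarrow> ennreal" where "w = indicator {0..1}"
  have [measurable]: "w \<in> borel_measurable borel"
    by (simp add: w_def)
  have w_shift: "(\<integral>\<^sup>+s. w (s - a) \<partial>lborel) = 1" for a
  proof -
    have "(\<integral>\<^sup>+s. w (s - a) \<partial>lborel) = (\<integral>\<^sup>+s. w s \<partial>lborel)"
      using nn_integral_lborel_translation[of w "- a"] by simp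
    then show ?thesis by (simp add: w_def)
  qed
  \<comment> \<open>The right-hand side does not mention \<open>\<phi>\<close>; comparing the given
    \<open>\<phi>\<close> with the zero function proves the claim.\<close>
  have average: "(\<integral>\<^sup>+x. f (x + \<phi> x *\<^sub>R e) \<partial>lborel)
    = (\<integral>\<^sup>+x. w (- (x \<bullet> e)) * (\<integral>\<^sup>+s. f (x + s *\<^sub>R e) \<partial>lborel) \<partial>lborel)"
    if [measurable]: "\<phi> \<in> borel_measurable borel" and inv: "\<And>x s. \<phi> (x + s *\<^sub>R e) = \<phi> x" for \<phi> :: "'a \<Rightarrow> real"
  proof -
    have "(\<integral>\<^sup>+x. f (x + \<phi> x *\<^sub>R e) \<partial>lborel)
      = (\<integral>\<^sup>+x. (\<integral>\<^sup>+s. w (s - x \<bullet> e) * f (x + \<phi> x *\<^sub>R e) \<partial>lborel) \<partial>lborel)"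
      by (simp add: nn_integral_multc w_shift)
    also have "\<dots> = (\<integral>\<^sup>+s. (\<integral>\<^sup>+x. w (s - x \<bullet> e) * f (x + \<phi> x *\<^sub>R e) \<partial>lborel) \<partial>lborel)"
      by (rule lborel_pair.Fubini') simp
    also have "\<dots> = (\<integral>\<^sup>+s. (\<integral>\<^sup>+x. w (- (x \<bullet> e)) * f (x + (\<phi> x + s) *\<^sub>R e) \<partial>lborel) \<partial>lborel)"
    \<comment> \<open>Translating \<open>x\<close> by \<open>s *\<^sub>R e\<close> removes
      \<open>s\<close> from the weight, since \<open>e \<bullet> e = 1\<close>, and moves it into
      the argument of \<open>f\<close>; \<open>\<phi>\<close> is invariant under this
      translation.\<close>
    proof (rule nn_integral_cong)
      fix s :: real
      have "(\<integral>\<^sup>+x. w (s - x \<bullet> e) * f (x + \<phi> x *\<^sub>R e) \<partial>lborel)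
        = (\<integral>\<^sup>+x. w (s - (x + s *\<^sub>R e) \<bullet> e) * f ((x + s *\<^sub>R e) + \<phi> (x + s *\<^sub>R e) *\<^sub>R e) \<partial>lborel)"
        by (rule nn_integral_lborel_translation[symmetric]) measurable
      then show "(\<integral>\<^sup>+x. w (s - x \<bullet> e) * f (x + \<phi> x *\<^sub>R e) \<partial>lborel)
        = (\<integral>\<^sup>+x. w (- (x \<bullet> e)) * f (x + (\<phi> x + s) *\<^sub>R e) \<partial>lborel)"
        by (simp add: inv inner_add_left e algebra_simps)
    qed
    also have "\<dots> = (\<integral>\<^sup>+x. (\<integral>\<^sup>+s. w (- (x \<bullet> e)) * f (x + (\<phi> x + s) *\<^sub>R e) \<partial>lborel) \<partial>lborel)"
      by (rule lborel_pair.Fubini'[symmetric]) simp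
    also have "\<dots> = (\<integral>\<^sup>+x. w (- (x \<bullet> e)) * (\<integral>\<^sup>+s. f (x + s *\<^sub>R e) \<partial>lborel) \<partial>lborel)"
    proof (rule nn_integral_cong)
      fix x :: 'a
      have "(\<integral>\<^sup>+s. f (x + (s + \<phi> x) *\<^sub>R e) \<partial>lborel) = (\<integral>\<^sup>+s. f (x + s *\<^sub>R e) \<partial>lborel)"
        by (rule nn_integral_lborel_translation) measurable
      then show "(\<integral>\<^sup>+s. w (- (x \<bullet> e)) * f (x + (\<phi> x + s) *\<^sub>R e) \<partial>lborel)
        = w (- (x \<bullet> e)) * (\<integral>\<^sup>+s. f (x + s *\<^sub>R e) \<partial>lborel)"
        by (simp add: nn_integral_cmult add.commute)
    qed
    finally show ?thesis .
  qed
  show ?thesis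
    using average[OF \<phi> inv] average[of "\<lambda>_. 0"] by simp
qed

text \<open>The formula is stable under composition, so it suffices to check elementary maps:
  diagonal scalings, transpositions of two coordinates and shears.\<close>

lemma nn_integral_lborel_linear:
  fixes T :: "real^'n^'n"
  assumes "det T \<noteq> 0" and "g \<in> borel_measurable borel"
  shows "(\<integral>\<^sup>+x. g (T *v x) \<partial>lborel) = ennreal (1 / \<bar>det T\<bar>) * (\<integral>\<^sup>+x. g x \<partial>lborel)"
proof -
  \<comment> \<open>Singular maps satisfy \<open>P\<close> vacuously, which disposes of the
    elementary maps with a zero row and lets the induction range over all linear maps.\<close>
  define P where "P f \<longleftrightarrow> det (matrix f) \<noteq> 0 \<longrightarrow> (\<forall>g :: real^'n \<Rightarrow> ennreal. g \<in> borel_measurable borel \<longrightarrow>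
    (\<integral>\<^sup>+x. g (f x) \<partial>lborel) = ennreal (1 / \<bar>det (matrix f)\<bar>) * (\<integral>\<^sup>+x. g x \<partial>lborel))"
    for f :: "real^'n \<Rightarrow> real^'n"
  have meas: "f \<in> borel_measurable borel" if "linear f" for f :: "real^'n \<Rightarrow> real^'n"
    using that by (intro borel_measurable_continuous_onI linear_continuous_on) (simp add: linear_conv_bounded_linear)
  have "P ((*v) T)"
  proof (rule induct_linear_elementary[where f = "(*v) T" and P = P])
    show "linear ((*v) T)"
      by (rule matrix_vector_mul_linear)
  next
    fix f g :: "real^'n \<Rightarrow> real^'n"
    assume lin: "linear f" "linear g" and P: "P f" "P g"
    note [measurable] = meas[OF lin(1)] meas[OF lin(2)]
    have det: "det (matrix (f \<circ> g)) = det (matrix f) * det (matrix g)"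
      using lin by (simp add: matrix_compose det_mul)
    show "P (f \<circ> g)"
      unfolding P_def
    proof (intro impI allI)
      fix k :: "real^'n \<Rightarrow> ennreal"
      assume [measurable]: "k \<in> borel_measurable borel" and "det (matrix (f \<circ> g)) \<noteq> 0"
      then have nz: "det (matrix f) \<noteq> 0" "det (matrix g) \<noteq> 0"
        by (auto simp: det)
      have "(\<integral>\<^sup>+x. k (f (g x)) \<partial>lborel) = ennreal (1 / \<bar>det (matrix g)\<bar>) * (\<integral>\<^sup>+x. k (f x) \<partial>lborel)"
        by (rule P(2)[unfolded P_def, rule_format, OF nz(2), of "\<lambda>x. k (f x)"]) measurable
      also have "(\<integral>\<^sup>+x. k (f x) \<partial>lborel) = ennreal (1 / \<bar>det (matrix f)\<bar>) * (\<integral>\<^sup>+x. k x \<partial>lborel)"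
        by (rule P(1)[unfolded P_def, rule_format, OF nz(1)]) measurable
      finally show "(\<integral>\<^sup>+x. k ((f \<circ> g) x) \<partial>lborel)
        = ennreal (1 / \<bar>det (matrix (f \<circ> g))\<bar>) * (\<integral>\<^sup>+x. k x \<partial>lborel)"
      proof -
        have "ennreal (1 / \<bar>det (matrix g)\<bar>) * ennreal (1 / \<bar>det (matrix f)\<bar>) = ennreal (1 / \<bar>det (matrix (f \<circ> g))\<bar>)"
          by (simp add: det abs_mult ennreal_mult'[symmetric] mult.commute)
        then show "(\<integral>\<^sup>+x. k (f (g x)) \<partial>lborel)
            = ennreal (1 / \<bar>det (matrix g)\<bar>) * (ennreal (1 / \<bar>det (matrix f)\<bar>) * (\<integral>\<^sup>+x. k x \<partial>lborel))
          \<Longrightarrow> (\<integral>\<^sup>+x. k ((f \<circ> g) x) \<partial>lborel) = ennreal (1 / \<bar>det (matrix (f \<circ> g))\<bar>) * (\<integral>\<^sup>+x. k x \<partial>lborel)"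
          by (simp add: mult.assoc[symmetric])
      qed
    qed
  next
    fix f :: "real^'n \<Rightarrow> real^'n" and i
    assume "linear f" and zero: "\<And>x. f x $ i = 0"
    have "row i (matrix f) = 0"
      by (simp add: row_def matrix_def zero vec_eq_iff)
    then show "P f"
      by (simp add: P_def det_zero_row)
  next
    fix c :: "'n \<Rightarrow> real"
    define f where "f = (\<lambda>x :: real^'n. \<chi> i. c i * x $ i)"
    have lin: "linear f"
      unfolding f_def by (rule linearI) (simp_all add: vec_eq_iff algebra_simps)
    note [measurable] = meas[OF lin]
    have "matrix f = (\<chi> i j. if i = j then c i else 0)"
      by (simp add: matrix_def f_def axis_def vec_eq_iff)
    then have det: "det (matrix f) = (\<Prod>i\<in>UNIV. c i)"
      by (subst det_diagonal) auto
    show "P (\<lambda>x. \<chi> i. c i * x $ i)"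
      unfolding f_def[symmetric] P_def
    proof (intro impI allI)
      fix g :: "real^'n \<Rightarrow> ennreal"
      assume [measurable]: "g \<in> borel_measurable borel" and nz: "det (matrix f) \<noteq> 0"
      have c: "c i \<noteq> 0" for i
        using nz by (auto simp: det)
      define e :: "'n \<Rightarrow> real^'n" where "e j = axis j 1" for j
      define c' where "c' b = c (inv_into UNIV e b)" for b
      have inj: "inj e"
        by (auto simp: e_def inj_on_def axis_eq_axis)
      have Basis: "Basis = range e"
        by (auto simp: Basis_vec_def e_def)
      have c': "c' (e j) = c j" for j
        by (simp add: c'_def inj)
      have nz_c': "c' b \<noteq> 0" if "b \<in> Basis" for b
        using that c by (auto simp: Basis c')
      have "0 + (\<Sum>b\<in>Basis. (c' b * (x \<bullet> b)) *\<^sub>R b) = f x" for x :: "real^'n"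
      proof -
        have "x \<bullet> e j = x $ j" "e j $ i = (if i = j then 1 else 0)" for i j
          by (simp_all add: e_def inner_axis) (simp add: axis_def)
        then show ?thesis
          unfolding Basis by (simp add: sum.reindex[OF inj] c' f_def vec_eq_iff if_distrib[of "\<lambda>z. _ * z"] cong: if_cong)
      qed
      then have "lborel = density (distr lborel borel f) (\<lambda>_. (\<Prod>b\<in>Basis. \<bar>c' b\<bar>))"
        using lborel_affine_euclidean[of c' 0] nz_c' by simp
      also have "(\<Prod>b\<in>Basis. \<bar>c' b\<bar>) = \<bar>det (matrix f)\<bar>"
        unfolding Basis by (simp add: prod.reindex[OF inj] c' det abs_prod)
      finally have "(\<integral>\<^sup>+x. g x \<partial>lborel) = (\<integral>\<^sup>+x. g x \<partial>density (distr lborel borel f) (\<lambda>_. ennreal \<bar>det (matrix f)\<bar>))"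
        by (rule arg_cong[of _ _ "\<lambda>M. integral\<^sup>N M g"])
      also have "\<dots> = ennreal \<bar>det (matrix f)\<bar> * (\<integral>\<^sup>+x. g (f x) \<partial>lborel)"
        by (simp add: nn_integral_density nn_integral_distr nn_integral_cmult)
      finally show "(\<integral>\<^sup>+x. g (f x) \<partial>lborel) = ennreal (1 / \<bar>det (matrix f)\<bar>) * (\<integral>\<^sup>+x. g x \<partial>lborel)"
        using nz by (simp add: mult.assoc[symmetric] ennreal_mult'[symmetric])
    qed
  next
    fix m n :: 'n
    assume "m \<noteq> n"
    define \<tau> where "\<tau> = Transposition.transpose m n"
    define f where "f = (\<lambda>x :: real^'n. \<chi> i. x $ \<tau> i)"
    have lin: "linear f"
      unfolding f_def by (rule linearI) (simp_all add: vec_eq_iff)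
    note [measurable] = meas[OF lin]
    have \<tau>: "\<tau> permutes UNIV" "\<tau> (\<tau> i) = i" for i
      by (simp_all add: \<tau>_def permutes_swap_id)
    have "matrix f = (\<chi> i. mat 1 $ \<tau> i)"
      by (simp add: matrix_def f_def axis_def mat_def vec_eq_iff)
    then have det: "\<bar>det (matrix f)\<bar> = 1"
      using det_permute_rows[OF \<tau>(1), of "mat 1 :: real^'n^'n"] by (simp add: sign_def)
    \<comment> \<open>A transposition of coordinates takes boxes to boxes of the same volume, and
      the measure of boxes determines Lebesgue measure.\<close>
    have "lborel = distr lborel borel f"
    proof (rule lborel_eqI)
      fix l u :: "real^'n"
      assume lu: "\<And>b. b \<in> Basis \<Longrightarrow> l \<bullet> b \<le> u \<bullet> b"
      have vimage: "f -` box l u = box (f l) (f u)"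
        by (simp add: set_eq_iff f_def mem_box_cart) (metis \<tau>(2))
      have box: "emeasure lborel (box l u) = ennreal (\<Prod>i\<in>UNIV. u$i - l$i)"
        if "\<And>i. l$i \<le> u$i" for l u :: "real^'n"
      proof -
        have "(\<Prod>b\<in>Basis. (u - l) \<bullet> b) = (\<Prod>i\<in>UNIV. u$i - l$i)"
          by (simp add: prod_Basis_cart inner_axis)
        then show ?thesis
          using that by (subst emeasure_lborel_box) (auto simp: Basis_vec_def inner_axis)
      qed
      have le: "l $ i \<le> u $ i" for i
        using lu[of "axis i 1"] by (simp add: inner_axis)
      have "emeasure (distr lborel borel f) (box l u) = ennreal (\<Prod>i\<in>UNIV. u $ \<tau> i - l $ \<tau> i)"
        using le by (simp add: emeasure_distr vimage box) (simp add: f_def box)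
      also have "(\<Prod>i\<in>UNIV. u $ \<tau> i - l $ \<tau> i) = (\<Prod>i\<in>UNIV. u $ i - l $ i)"
        using prod.permute[OF \<tau>(1), of "\<lambda>i. u $ i - l $ i"] by (simp add: o_def)
      also have "ennreal \<dots> = emeasure lborel (box l u)"
        using box le by simp
      finally show "emeasure (distr lborel borel f) (box l u) = (\<Prod>b\<in>Basis. (u - l) \<bullet> b)"
        using lu by simp
    qed simp
    from this[symmetric] have "(\<integral>\<^sup>+x. g (f x) \<partial>lborel) = (\<integral>\<^sup>+x. g x \<partial>lborel)"
      if "g \<in> borel_measurable borel" for g :: "real^'n \<Rightarrow> ennreal"
      using nn_integral_distr[of f lborel borel g] that by simp
    then show "P (\<lambda>x. \<chi> i. x $ Transposition.transpose m n i)"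
      unfolding \<tau>_def[symmetric] f_def[symmetric] P_def by (simp add: det)
  next
    fix m n :: 'n
    assume mn: "m \<noteq> n"
    define f where "f = (\<lambda>x :: real^'n. \<chi> i. if i = m then x$m + x$n else x$i)"
    \<comment> \<open>This is a shear along \<open>axis m 1\<close> by the amount
      \<open>x $ n\<close>, which does not change along that axis because
      \<open>m \<noteq> n\<close>.\<close>
    have f_eq: "f x = x + (x $ n) *\<^sub>R axis m 1" for x
      by (simp add: f_def vec_eq_iff axis_def)
    have "matrix f = (\<chi> k. if k = m then row m (mat 1) + 1 *s row n (mat 1) else row k (mat 1))"
      by (auto simp: matrix_def f_def axis_def mat_def row_def vec_eq_iff)
    then have det: "det (matrix f) = 1"
      using det_row_operation[OF mn, of "mat 1 :: real^'n^'n" 1] by simp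
    have "(\<integral>\<^sup>+x. g (f x) \<partial>lborel) = (\<integral>\<^sup>+x. g x \<partial>lborel)" if "g \<in> borel_measurable borel" for g
      unfolding f_eq using mn
      by (intro nn_integral_lborel_shear that) (simp_all add: inner_axis_axis, simp add: axis_def)
    then show "P (\<lambda>x. \<chi> i. if i = m then x$m + x$n else x$i)"
      unfolding f_def[symmetric] P_def by (simp add: det)
  qed
  then show ?thesis
    using assms by (simp add: P_def matrix_of_matrix_vector_mul)
qed

section \<open>Energy and Hausdorff measure\<close>

lemma riesz_ge:
  assumes "norm x \<le> d" "0 \<le> \<gamma>"
  shows "ennreal (d powr (- \<gamma>)) \<le> riesz \<gamma> x"
  using assms by (auto simp: riesz_def intro!: ennreal_leI powr_mono2')

text \<open>A cover of the range, pulled back and made disjoint, splits \<open>N\<close> into cells.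
  On a cell of mass \<open>a\<close> whose image has diameter at most \<open>d\<close>, the kernel
  is at least \<open>d powr (- \<gamma>)\<close>, so the cell contributes at least
  \<open>d powr (- \<gamma>) * a\<^sup>2\<close> to the energy. As the masses add up to 1, finite
  energy bounds the sum of the powers of the diameters away from 0, uniformly over all covers by
  sets of diameter at most 1.\<close>

lemma finite_energy_imp_hausdorff_measure_neq_0:
  fixes X :: "'a \<Rightarrow> 'b::euclidean_space"
  assumes "prob_space N" and [measurable]: "X \<in> borel_measurable N"
    and energy: "(\<integral>\<^sup>+z. riesz \<gamma> (X (fst z) - X (snd z)) \<partial>(N \<Otimes>\<^sub>M N)) < \<infinity>"
    and "0 < \<gamma>" "0 \<le> s" "s \<le> \<gamma>"
  shows "hausdorff_measure s (X ` space N) \<noteq> 0"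
proof -
  interpret prob_space N by fact
  define k where "k z = riesz \<gamma> (X (fst z) - X (snd z))" for z
  have [measurable]: "k \<in> borel_measurable (N \<Otimes>\<^sub>M N)"
    unfolding k_def by measurable
  define \<nu> where "\<nu> = density (N \<Otimes>\<^sub>M N) k"
  have sets_\<nu>: "sets \<nu> = sets (N \<Otimes>\<^sub>M N)" and space_\<nu>: "space \<nu> = space (N \<Otimes>\<^sub>M N)"
    by (simp_all add: \<nu>_def)
  have emeasure_\<nu>: "emeasure \<nu> (space \<nu>) = (\<integral>\<^sup>+z. k z \<partial>(N \<Otimes>\<^sub>M N))"
    unfolding space_\<nu> by (simp add: \<nu>_def emeasure_density)
  define I where "I = enn2real (emeasure \<nu> (space \<nu>))"
  have I: "I \<ge> 0" "emeasure \<nu> (space \<nu>) = ennreal I"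
    using energy by (simp_all add: I_def emeasure_\<nu> k_def)
  \<comment> \<open>Any constant above the total energy \<open>I\<close> works: the final estimate
    would contradict \<open>I < c\<close>.\<close>
  define c where "c = I + 1"
  have c: "c > 0" using I by (simp add: c_def)
  have lower: "ennreal (1 / c) \<le> (\<Sum>i. diam_pow s (U i))"
    if cover: "X ` space N \<subseteq> (\<Union>i. U i)" and U: "\<And>i. bounded (U i)" "\<And>i. diameter (U i) \<le> 1"
    for U :: "nat \<Rightarrow> 'b set"
  proof -
    \<comment> \<open>Covering sets may be non-measurable; their closures have measurable preimages
      and the same diameters.\<close>
    define T where "T i = X -` closure (U i) \<inter> space N" for i
    have [measurable]: "T i \<in> sets N" for i
      unfolding T_def by measurable
    have UN_T: "(\<Union>i. T i) = space N"
    proof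
      show "space N \<subseteq> (\<Union>i. T i)"
      proof
        fix x assume x: "x \<in> space N"
        then obtain i where "X x \<in> U i"
          using cover by auto
        then show "x \<in> (\<Union>i. T i)"
          using x closure_subset[of "U i"] by (auto simp: T_def)
      qed
    qed (auto simp: T_def)
    define T' where "T' = disjointed T"
    have T'_T: "T' i \<subseteq> T i" for i
      unfolding T'_def by (rule disjointed_subset)
    have T'_sets [measurable]: "T' i \<in> sets N" for i
      unfolding T'_def using sets.range_disjointed_sets[of T N] \<open>\<And>i. T i \<in> sets N\<close> by blast
    have UN_T': "(\<Union>i. T' i) = space N"
      unfolding T'_def UN_disjointed_eq by (rule UN_T)
    have disj: "disjoint_family T'"
      unfolding T'_def by (rule disjoint_family_disjointed)
    define a where "a i = measure N (T' i)" for i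
    have a: "a i \<ge> 0" "emeasure N (T' i) = ennreal (a i)" for i
      by (simp_all add: a_def emeasure_eq_measure)
    have sum_a: "(\<Sum>i. ennreal (2 * c * a i)) = ennreal (2 * c)"
    proof -
      have "(\<Sum>i. emeasure N (T' i)) = 1"
        using suminf_emeasure[of T' N] T'_sets disj emeasure_space_1 UN_T' by (simp add: image_subset_iff)
      then have "ennreal (2 * c) * (\<Sum>i. ennreal (a i)) = ennreal (2 * c)"
        by (simp add: a(2))
      then show ?thesis
        using c a(1) by (simp add: ennreal_mult)
    qed
    have sum_e: "(\<Sum>i. emeasure \<nu> (T' i \<times> T' i)) \<le> ennreal I"
    proof -
      have "disjoint_family (\<lambda>i. T' i \<times> T' i)"
        using disj by (auto simp: disjoint_family_on_def)
      then have "(\<Sum>i. emeasure \<nu> (T' i \<times> T' i)) = emeasure \<nu> (\<Union>i. T' i \<times> T' i)"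
        by (intro suminf_emeasure) (auto simp: sets_\<nu>)
      also have "\<dots> \<le> emeasure \<nu> (space \<nu>)"
        by (rule emeasure_space)
      finally show ?thesis by (simp add: I)
    qed
    have summand: "ennreal (2 * c * a i) \<le> emeasure \<nu> (T' i \<times> T' i) + ennreal (c\<^sup>2) * diam_pow s (U i)" for i
    proof (cases "a i = 0")
      case False
      then have "T' i \<noteq> {}" by (auto simp: a_def)
      then have "closure (U i) \<noteq> {}"
        using T'_T[of i] by (auto simp: T_def)
      then have ne: "U i \<noteq> {}" by auto
      define d where "d = diameter (U i)"
      have d: "d \<ge> 0" "d \<le> 1"
        using U[of i] by (simp_all add: d_def diameter_ge_0)
      have dist: "norm (X t - X t') \<le> d" if "t \<in> T' i" "t' \<in> T' i" for t t'
        using that T'_T[of i] diameter_bounded_bound[of "closure (U i)" "X t" "X t'"] U(1)[of i]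
        by (auto simp: T_def d_def diameter_closure dist_norm)
      \<comment> \<open>\<open>b\<close> is extended real because it is used with
        \<open>\<top>\<close>, to exclude cells of positive mass mapped to a single point, as well
        as with \<open>d powr (- \<gamma>)\<close>.\<close>
      have ge: "b * ennreal ((a i)\<^sup>2) \<le> emeasure \<nu> (T' i \<times> T' i)"
        if b: "\<And>t t'. t \<in> T' i \<Longrightarrow> t' \<in> T' i \<Longrightarrow> b \<le> k (t, t')" for b :: ennreal
      proof -
        have "b * ennreal ((a i)\<^sup>2) = b * emeasure (N \<Otimes>\<^sub>M N) (T' i \<times> T' i)"
          by (simp add: emeasure_pair_measure_Times a power2_eq_square ennreal_mult)
        also have "\<dots> = (\<integral>\<^sup>+z. b * indicator (T' i \<times> T' i) z \<partial>(N \<Otimes>\<^sub>M N))"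
          by (simp add: nn_integral_cmult_indicator)
        also have "\<dots> \<le> (\<integral>\<^sup>+z. k z * indicator (T' i \<times> T' i) z \<partial>(N \<Otimes>\<^sub>M N))"
          using b by (intro nn_integral_mono) (auto simp: indicator_def)
        also have "\<dots> = emeasure \<nu> (T' i \<times> T' i)"
          by (simp add: \<nu>_def emeasure_density)
        finally show ?thesis .
      qed
      have "d \<noteq> 0"
      proof
        assume "d = 0"
        then have "\<top> * ennreal ((a i)\<^sup>2) \<le> emeasure \<nu> (T' i \<times> T' i)"
        proof (intro ge)
          fix t t' assume "t \<in> T' i" "t' \<in> T' i"
          then have "X t - X t' = 0"
            using dist[of t t'] \<open>d = 0\<close> by simp
          then show "\<top> \<le> k (t, t')"
            by (simp add: k_def riesz_def)
        qed
        then have "emeasure \<nu> (T' i \<times> T' i) = \<top>"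
          using False by (simp add: ennreal_top_mult top_unique)
        moreover have "emeasure \<nu> (T' i \<times> T' i) \<le> ennreal I"
          unfolding I(2)[symmetric] by (rule emeasure_space)
        ultimately show False by (simp add: top_unique)
      qed
      then have d0: "d > 0" using d by simp
      define u where "u = d powr (\<gamma> / 2)"
      have u: "u > 0" "u\<^sup>2 = d powr \<gamma>" "(1 / u)\<^sup>2 = d powr (- \<gamma>)"
        using d0 by (simp_all add: u_def power2_eq_square powr_add[symmetric] powr_minus divide_simps)
      \<comment> \<open>The inequality between arithmetic and geometric means makes the bound linear
        in the mass, so that it can be summed over the cells.\<close>
      have "2 * c * a i \<le> d powr (- \<gamma>) * (a i)\<^sup>2 + c\<^sup>2 * d powr \<gamma>"
      proof -
        have "0 \<le> (a i * (1 / u) - c * u)\<^sup>2" by simp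
        also have "\<dots> = d powr (- \<gamma>) * (a i)\<^sup>2 + c\<^sup>2 * d powr \<gamma> - 2 * c * a i"
          unfolding u(2,3)[symmetric] using u(1) by (simp add: power2_eq_square field_simps)
        finally show ?thesis by simp
      qed
      then have "ennreal (2 * c * a i) \<le> ennreal (d powr (- \<gamma>)) * ennreal ((a i)\<^sup>2) + ennreal (c\<^sup>2) * ennreal (d powr \<gamma>)"
        by (simp add: ennreal_mult[symmetric] ennreal_plus[symmetric] del: ennreal_plus)
      also have "\<dots> \<le> emeasure \<nu> (T' i \<times> T' i) + ennreal (c\<^sup>2) * diam_pow s (U i)"
      proof (intro add_mono mult_left_mono ge)
        show "ennreal (d powr (- \<gamma>)) \<le> k (t, t')" if "t \<in> T' i" "t' \<in> T' i" for t t'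
          unfolding k_def using dist[OF that] \<open>0 < \<gamma>\<close> by (auto intro: riesz_ge)
        \<comment> \<open>Passing from \<open>\<gamma>\<close> to the smaller exponent
          \<open>s\<close> uses \<open>d \<le> 1\<close>, which is why only covers at scale 1 are
          considered.\<close>
        have "d powr \<gamma> \<le> d powr s"
          using d d0 \<open>s \<le> \<gamma>\<close> by (intro powr_mono') auto
        then show "ennreal (d powr \<gamma>) \<le> diam_pow s (U i)"
          using ne d0 by (auto simp: diam_pow_def d_def[symmetric])
      qed auto
      finally show ?thesis .
    qed simp
    have "ennreal (2 * c) \<le> (\<Sum>i. emeasure \<nu> (T' i \<times> T' i) + ennreal (c\<^sup>2) * diam_pow s (U i))"
      unfolding sum_a[symmetric] by (intro suminf_le summand) auto
    also have "\<dots> = (\<Sum>i. emeasure \<nu> (T' i \<times> T' i)) + ennreal (c\<^sup>2) * (\<Sum>i. diam_pow s (U i))"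
      by (subst suminf_add[symmetric]) auto
    also have "\<dots> \<le> ennreal I + ennreal (c\<^sup>2) * (\<Sum>i. diam_pow s (U i))"
      by (intro add_right_mono sum_e)
    finally have main: "ennreal (2 * c) \<le> ennreal I + ennreal (c\<^sup>2) * (\<Sum>i. diam_pow s (U i))" .
    show ?thesis
    proof (rule ccontr)
      assume "\<not> ?thesis"
      then have "ennreal (c\<^sup>2) * (\<Sum>i. diam_pow s (U i)) \<le> ennreal (c\<^sup>2) * ennreal (1 / c)"
        by (intro mult_left_mono) auto
      also have "\<dots> = ennreal c"
        using c by (simp add: ennreal_mult[symmetric] power2_eq_square)
      finally have "ennreal (2 * c) \<le> ennreal I + ennreal c"
        using main by (meson add_left_mono order_trans)
      then have "2 * c \<le> I + c"
        using I(1) c by (simp add: ennreal_plus[symmetric] del: ennreal_plus)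
      then show False by (simp add: c_def)
    qed
  qed
  have "0 < ennreal (1 / c)"
    using c by simp
  also have "\<dots> \<le> hausdorff_content s 1 (X ` space N)"
    unfolding hausdorff_content_def by (rule INF_greatest) (use lower in blast)
  also have "\<dots> \<le> hausdorff_measure s (X ` space N)"
    unfolding hausdorff_measure_def by (rule SUP_upper) simp
  finally show ?thesis by simp
qed

section \<open>Riesz integrals along powers of a matrix\<close>

lemma prod_ennreal_neq_0:
  fixes f :: "'i \<Rightarrow> ennreal"
  assumes "finite I" "\<And>i. i \<in> I \<Longrightarrow> f i \<noteq> 0"
  shows "prod f I \<noteq> 0"
  using assms by (induction I rule: finite_induct) auto

lemma prod_ennreal_less_top:
  fixes f :: "'i \<Rightarrow> ennreal"
  assumes "finite I" "\<And>i. i \<in> I \<Longrightarrow> f i < \<top>"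
  shows "prod f I < \<top>"
  using assms by (induction I rule: finite_induct) (auto simp: ennreal_mult_less_top)

text \<open>Each inequality \<open>\<bar>y j\<bar> / b j \<le> norm z\<close> is raised to the power
  \<open>- \<eta> j\<close>, and the results are multiplied; the exponents on the left add up to
  \<open>- \<gamma>\<close>.\<close>

lemma riesz_le_prod_riesz:
  fixes y :: "'n::finite \<Rightarrow> real"
  assumes b: "\<And>j. b j > 0" and y: "\<And>j. \<bar>y j\<bar> \<le> b j * norm z"
    and \<eta>: "\<And>j. 0 \<le> \<eta> j" "(\<Sum>j\<in>UNIV. \<eta> j) = \<gamma>"
  shows "riesz \<gamma> z \<le> ennreal (\<Prod>j\<in>UNIV. b j powr \<eta> j) * (\<Prod>j\<in>UNIV. riesz (\<eta> j) (y j))"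
\<comment> \<open>A vanishing \<open>y j\<close> makes the right-hand side \<open>\<top>\<close>,
  since no other factor is 0. This includes the case \<open>z = 0\<close>.\<close>
proof (cases "\<exists>j. y j = 0")
  case True
  then obtain j where "y j = 0" by blast
  then have "(\<Prod>j\<in>UNIV. riesz (\<eta> j) (y j)) = \<top> * (\<Prod>j\<in>UNIV - {j}. riesz (\<eta> j) (y j))"
    by (subst prod.remove[of UNIV j]) (auto simp: riesz_def)
  moreover have "(\<Prod>j\<in>UNIV - {j}. riesz (\<eta> j) (y j)) \<noteq> 0"
    by (intro prod_ennreal_neq_0 riesz_neq_0) simp
  moreover have "(\<Prod>j\<in>UNIV. b j powr \<eta> j) > 0"
    using b by (intro prod_pos ballI) (simp add: less_imp_neq[THEN not_sym])
  ultimately show ?thesis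
    by (simp add: ennreal_mult_top b[THEN less_imp_neq, THEN not_sym])
next
  case False
  have z: "norm z > 0"
  proof -
    have "\<bar>y undefined\<bar> > 0" using False by simp
    then have "b undefined * norm z > 0"
      using y[of undefined] by (rule less_le_trans)
    then show ?thesis by (auto simp: zero_less_mult_iff)
  qed
  have "norm z powr (- \<gamma>) = (\<Prod>j\<in>UNIV. norm z powr (- \<eta> j))"
    using z by (simp add: \<eta>(2)[symmetric] powr_sum[symmetric] sum_negf)
  also have "\<dots> \<le> (\<Prod>j\<in>UNIV. b j powr \<eta> j * \<bar>y j\<bar> powr (- \<eta> j))"
  proof (intro prod_mono conjI)
    fix j
    have "\<bar>y j\<bar> / b j \<le> norm z"
      using y[of j] b[of j] by (simp add: divide_le_eq mult.commute)
    then have "norm z powr (- \<eta> j) \<le> (\<bar>y j\<bar> / b j) powr (- \<eta> j)"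
      using False b[of j] \<eta>(1)[of j] by (intro powr_mono2') auto
    also have "\<dots> = b j powr \<eta> j * \<bar>y j\<bar> powr (- \<eta> j)"
      using b[of j] by (simp add: powr_divide powr_minus divide_simps)
    finally show "norm z powr (- \<eta> j) \<le> b j powr \<eta> j * \<bar>y j\<bar> powr (- \<eta> j)" .
  qed auto
  also have "\<dots> = (\<Prod>j\<in>UNIV. b j powr \<eta> j) * (\<Prod>j\<in>UNIV. \<bar>y j\<bar> powr (- \<eta> j))"
    by (rule prod.distrib)
  finally have "ennreal (norm z powr (- \<gamma>))
    \<le> ennreal ((\<Prod>j\<in>UNIV. b j powr \<eta> j) * (\<Prod>j\<in>UNIV. \<bar>y j\<bar> powr (- \<eta> j)))"
    by (rule ennreal_leI)
  also have "\<dots> = ennreal (\<Prod>j\<in>UNIV. b j powr \<eta> j) * (\<Prod>j\<in>UNIV. ennreal (\<bar>y j\<bar> powr (- \<eta> j)))"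
    by (subst ennreal_mult) (auto intro!: prod_nonneg simp: prod_ennreal)
  finally show ?thesis
    using False z by (simp add: riesz_def)
qed

text \<open>The iterate enters only through the constants \<open>b j\<close>, whose weighted product
  is the power of \<open>c\<close> in the bound. What remains is one fixed integral in the
  coordinates \<open>T *v x\<close>, which factorises into integrals over the line.\<close>

lemma nn_integral_riesz_linear_images:
  fixes V T :: "real^'n^'n" and \<kappa> \<eta> :: "'n \<Rightarrow> real"
  assumes T: "det T \<noteq> 0" and c: "0 < c" and K: "0 < K"
    and exp: "\<And>n x i. \<bar>(T *v x)$i\<bar> \<le> K * c powr (- (real n * (\<kappa> i + \<epsilon>))) * norm ((((*v) V) ^^ n) x)"
    and \<eta>: "\<And>j. 0 \<le> \<eta> j" "\<And>j. \<eta> j < 1" "(\<Sum>j\<in>UNIV. \<eta> j) = \<gamma>"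
  obtains C where "0 \<le> C" "\<And>n. (\<integral>\<^sup>+x. indicator (cbox (- 1) 1) x * riesz \<gamma> ((((*v) V) ^^ n) x) \<partial>lborel)
    \<le> ennreal (C * c powr (- (real n * ((\<Sum>j\<in>UNIV. \<kappa> j * \<eta> j) + \<epsilon> * \<gamma>))))"
proof -
  have lin: "linear ((*v) T)"
    by (rule matrix_vector_mul_linear)
  have "bounded ((*v) T ` cbox (- 1) 1)"
    using lin by (intro bounded_linear_image) (auto simp: linear_conv_bounded_linear)
  then obtain R where R: "R > 0" "\<And>x. x \<in> cbox (- 1) 1 \<Longrightarrow> norm (T *v x) \<le> R"
    by (auto simp: bounded_pos)
  \<comment> \<open>The cutoff at \<open>R\<close> enlarges the image of the cube under
    \<open>T\<close> to a product of intervals, which the factorisation needs.\<close>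
  define F where "F j y = indicator {- R..R} y * riesz (\<eta> j) y" for j and y :: real
  have [measurable]: "F j \<in> borel_measurable borel" for j
    unfolding F_def by measurable
  define J where "J = (\<Prod>j\<in>UNIV. \<integral>\<^sup>+y. F j y \<partial>lborel)"
  have J: "J < \<infinity>"
    unfolding J_def F_def
    using nn_integral_riesz_finite[OF \<eta>(1,2), of R] R(1)
    by (simp add: prod_ennreal_less_top)
  define a where "a n = c powr (- (real n * ((\<Sum>j\<in>UNIV. \<kappa> j * \<eta> j) + \<epsilon> * \<gamma>)))" for n
  have "(\<integral>\<^sup>+x. indicator (cbox (- 1) 1) x * riesz \<gamma> ((((*v) V) ^^ n) x) \<partial>lborel)
    \<le> ennreal ((K powr \<gamma> * (1 / \<bar>det T\<bar>) * enn2real J) * a n)" for n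
  proof -
    define b where "b j = K * c powr (- (real n * (\<kappa> j + \<epsilon>)))" for j
    have b: "b j > 0" for j
      using K c by (simp add: b_def)
    have prod_b: "(\<Prod>j\<in>UNIV. b j powr \<eta> j) = K powr \<gamma> * a n"
    proof -
      have "(\<Prod>j\<in>UNIV. b j powr \<eta> j) = (\<Prod>j\<in>UNIV. K powr \<eta> j * c powr (- (real n * (\<kappa> j + \<epsilon>)) * \<eta> j))"
        using K c by (intro prod.cong) (auto simp: b_def powr_mult powr_powr)
      also have "\<dots> = K powr \<gamma> * c powr (\<Sum>j\<in>UNIV. - (real n * (\<kappa> j + \<epsilon>)) * \<eta> j)"
        using K c by (simp add: prod.distrib powr_sum[symmetric] \<eta>(3))
      also have "(\<Sum>j\<in>UNIV. - (real n * (\<kappa> j + \<epsilon>)) * \<eta> j) = - (real n * ((\<Sum>j\<in>UNIV. \<kappa> j * \<eta> j) + \<epsilon> * \<gamma>))"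
      proof -
        have "(\<Sum>j\<in>UNIV. - (real n * (\<kappa> j + \<epsilon>)) * \<eta> j)
          = (\<Sum>j\<in>UNIV. (- real n) * (\<kappa> j * \<eta> j) + (- real n * \<epsilon>) * \<eta> j)"
          by (simp add: algebra_simps)
        also have "\<dots> = (- real n) * (\<Sum>j\<in>UNIV. \<kappa> j * \<eta> j) + (- real n * \<epsilon>) * (\<Sum>j\<in>UNIV. \<eta> j)"
          by (simp only: sum.distrib sum_distrib_left)
        finally show ?thesis
          by (simp add: \<eta>(3) algebra_simps)
      qed
      finally show ?thesis by (simp add: a_def)
    qed
    have "(\<integral>\<^sup>+x. indicator (cbox (- 1) 1) x * riesz \<gamma> ((((*v) V) ^^ n) x) \<partial>lborel)
      \<le> (\<integral>\<^sup>+x. ennreal (K powr \<gamma> * a n) * (\<Prod>j\<in>UNIV. F j ((T *v x)$j)) \<partial>lborel)"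
    proof (rule nn_integral_mono)
      fix x :: "real^'n"
      show "indicator (cbox (- 1) 1) x * riesz \<gamma> ((((*v) V) ^^ n) x)
        \<le> ennreal (K powr \<gamma> * a n) * (\<Prod>j\<in>UNIV. F j ((T *v x)$j))"
      proof (cases "x \<in> cbox (- 1) 1")
        case True
        have "F j ((T *v x)$j) = riesz (\<eta> j) ((T *v x)$j)" for j
          using Finite_Cartesian_Product.norm_nth_le[of "T *v x" j] R(2)[OF True]
          by (auto simp: F_def indicator_def abs_le_iff)
        then show ?thesis
          using True riesz_le_prod_riesz[where b = b and y = "\<lambda>j. (T *v x)$j" and z = "(((*v) V) ^^ n) x" and \<eta> = \<eta> and \<gamma> = \<gamma>] b exp \<eta>
          by (simp add: prod_b[symmetric] b_def)
      qed simp
    qed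
    also have "\<dots> = ennreal (K powr \<gamma> * a n) * (\<integral>\<^sup>+x. (\<Prod>j\<in>UNIV. F j ((T *v x)$j)) \<partial>lborel)"
    proof (rule nn_integral_cmult)
      have [measurable]: "(\<lambda>x. (T *v x)$j) \<in> borel_measurable borel" for j
        using lin by (intro borel_measurable_continuous_onI continuous_intros linear_continuous_on)
          (simp add: linear_conv_bounded_linear)
      show "(\<lambda>x. \<Prod>j\<in>UNIV. F j ((T *v x)$j)) \<in> borel_measurable lborel"
        by measurable
    qed
    also have "(\<integral>\<^sup>+x. (\<Prod>j\<in>UNIV. F j ((T *v x)$j)) \<partial>lborel) = ennreal (1 / \<bar>det T\<bar>) * J"
      using nn_integral_lborel_linear[OF T, of "\<lambda>y. \<Prod>j\<in>UNIV. F j (y$j)"]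
      by (simp add: J_def nn_integral_lborel_prod_cart)
    also have "J = ennreal (enn2real J)"
      using J by simp
    also have "ennreal (K powr \<gamma> * a n) * (ennreal (1 / \<bar>det T\<bar>) * ennreal (enn2real J))
      = ennreal ((K powr \<gamma> * (1 / \<bar>det T\<bar>) * enn2real J) * a n)"
      by (simp add: ennreal_mult[symmetric] a_def algebra_simps)
    finally show ?thesis .
  qed
  then show thesis
    by (intro that[of "K powr \<gamma> * (1 / \<bar>det T\<bar>) * enn2real J"]) (auto simp: a_def)
qed

section \<open>Self-affine random fields\<close>

lemma borel_measurable_matrix_funpow [measurable]:
  fixes A :: "real^'n^'n"
  shows "((*v) A) ^^ n \<in> borel_measurable borel"
proof (induction n)
  case (Suc n)
  have "(*v) A \<in> borel_measurable borel"
    by (intro borel_measurable_continuous_onI linear_continuous_on)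
       (simp add: linear_conv_bounded_linear[symmetric] matrix_vector_mul_linear)
  then show ?case
    using measurable_comp[OF Suc] by simp
qed simp

lemma nn_integral_lborel_funpow:
  fixes A :: "real^'n^'n"
  assumes "det A \<noteq> 0" "f \<in> borel_measurable borel"
  shows "(\<integral>\<^sup>+x. f x \<partial>lborel) = ennreal (\<bar>det A\<bar> ^ n) * (\<integral>\<^sup>+x. f ((((*v) A) ^^ n) x) \<partial>lborel)"
proof (induction n)
  case (Suc n)
  note [measurable] = assms(2)
  have "(\<integral>\<^sup>+x. f ((((*v) A) ^^ Suc n) x) \<partial>lborel)
    = ennreal (1 / \<bar>det A\<bar>) * (\<integral>\<^sup>+x. f ((((*v) A) ^^ n) x) \<partial>lborel)"
    unfolding funpow_Suc_right o_apply
    by (rule nn_integral_lborel_linear[OF assms(1), of "\<lambda>x. f ((((*v) A) ^^ n) x)"]) measurable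
  then have "ennreal (\<bar>det A\<bar> ^ Suc n) * (\<integral>\<^sup>+x. f ((((*v) A) ^^ Suc n) x) \<partial>lborel)
    = ennreal (\<bar>det A\<bar> ^ Suc n) * ennreal (1 / \<bar>det A\<bar>) * (\<integral>\<^sup>+x. f ((((*v) A) ^^ n) x) \<partial>lborel)"
    by (simp only: mult.assoc)
  also have "ennreal (\<bar>det A\<bar> ^ Suc n) * ennreal (1 / \<bar>det A\<bar>) = ennreal (\<bar>det A\<bar> ^ n)"
    using assms(1) by (simp add: ennreal_mult[symmetric])
  finally show ?case
    using Suc by simp
qed simp

lemma same_fdd_imp_distr_eq:
  assumes "same_fdd M X Y" and [measurable]: "X t \<in> borel_measurable M" "Y t \<in> borel_measurable M"
  shows "distr M borel (X t) = distr M borel (Y t)"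
proof -
  have eq: "distr M (\<Pi>\<^sub>M s\<in>{t}. borel) (\<lambda>\<omega>. \<lambda>s\<in>{t}. X s \<omega>) = distr M (\<Pi>\<^sub>M s\<in>{t}. borel) (\<lambda>\<omega>. \<lambda>s\<in>{t}. Y s \<omega>)"
    using assms(1) by (simp add: same_fdd_def)
  have proj: "distr (distr M (\<Pi>\<^sub>M s\<in>{t}. borel) (\<lambda>\<omega>. \<lambda>s\<in>{t}. Z s \<omega>)) borel (\<lambda>f. f t) = distr M borel (Z t)"
    if [measurable]: "Z t \<in> borel_measurable M" for Z
  proof -
    have [measurable]: "(\<lambda>\<omega>. \<lambda>s\<in>{t}. Z s \<omega>) \<in> M \<rightarrow>\<^sub>M (\<Pi>\<^sub>M s\<in>{t}. borel)"
      by (rule measurable_restrict) simp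
    show ?thesis
      by (subst distr_distr) (auto simp: comp_def intro: measurable_component_singleton)
  qed
  show ?thesis
    using proj[of X] proj[of Y] eq by simp
qed

text \<open>\<open>occupation_intensity\<close> is only a set function; by Fubini it is the image of
  the product of Lebesgue measure and \<open>M\<close> under the graph map, and thus a genuine
  measure to integrate against.\<close>

lemma emeasure_occupation_distr:
  fixes X :: "real^'d \<Rightarrow> 'w \<Rightarrow> real^'m"
  assumes "prob_space M" and X: "(\<lambda>(t, \<omega>). X t \<omega>) \<in> borel \<Otimes>\<^sub>M M \<rightarrow>\<^sub>M borel" and A: "A \<in> sets borel"
  shows "emeasure (distr (lborel \<Otimes>\<^sub>M M) borel (\<lambda>z. (fst z, X (fst z) (snd z)))) A = occupation_intensity M X A"
proof -
  interpret M: prob_space M by fact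
  interpret pair_sigma_finite lborel M ..
  have X': "(\<lambda>z. X (fst z) (snd z)) \<in> borel_measurable (borel \<Otimes>\<^sub>M M)"
    using X by (simp add: case_prod_beta')
  have Y: "(\<lambda>z. (fst z, X (fst z) (snd z))) \<in> borel_measurable (lborel \<Otimes>\<^sub>M M)"
    unfolding borel_prod[symmetric] using X' by measurable
  have "emeasure (distr (lborel \<Otimes>\<^sub>M M) borel (\<lambda>z. (fst z, X (fst z) (snd z)))) A
    = (\<integral>\<^sup>+\<omega>. emeasure lborel ((\<lambda>t. (t, \<omega>)) -` ((\<lambda>z. (fst z, X (fst z) (snd z))) -` A \<inter> space (lborel \<Otimes>\<^sub>M M))) \<partial>M)"
    by (subst emeasure_distr[OF Y A]) (rule emeasure_pair_measure_alt2[OF measurable_sets[OF Y A]])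
  also have "\<dots> = occupation_intensity M X A"
    unfolding occupation_intensity_def
  proof (rule nn_integral_cong)
    fix \<omega> assume \<omega>: "\<omega> \<in> space M"
    have "(\<lambda>t. X t \<omega>) \<in> borel_measurable borel"
      using measurable_compose[OF measurable_Pair2'[OF \<omega>] X'] by simp
    then have "(\<lambda>t. (t, X t \<omega>)) \<in> borel_measurable lborel"
      unfolding borel_prod[symmetric] by measurable
    then show "emeasure lborel ((\<lambda>t. (t, \<omega>)) -` ((\<lambda>z. (fst z, X (fst z) (snd z))) -` A \<inter> space (lborel \<Otimes>\<^sub>M M)))
      = emeasure (occupation X \<omega>) A"
      using \<omega> A by (simp add: occupation_def emeasure_distr)
        (intro arg_cong[of _ _ "emeasure lborel"], auto simp: space_pair_measure)
  qed
  finally show ?thesis .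
qed

text \<open>The b.c.i. condition compares measures of Borel sets. Restricting the intensity measure
  to the shell turns it into an inequality between measures, which extends to nonnegative
  functions.\<close>

lemma bci_nn_integral:
  fixes X :: "real^'d \<Rightarrow> 'w \<Rightarrow> real^'m"
  assumes "prob_space M" and X: "(\<lambda>(t, \<omega>). X t \<omega>) \<in> borel \<Otimes>\<^sub>M M \<rightarrow>\<^sub>M borel"
    and "bci M X W" and S [measurable]: "sym_cube - W ` sym_cube \<in> sets borel"
  obtains C :: real where "\<And>f. f \<in> borel_measurable borel \<Longrightarrow>
    (\<integral>\<^sup>+t. \<integral>\<^sup>+\<omega>. indicator (sym_cube - W ` sym_cube) (t, X t \<omega>) * f (t, X t \<omega>) \<partial>M \<partial>lborel)
    \<le> ennreal C * (\<integral>\<^sup>+z. indicator (sym_cube - W ` sym_cube) z * f z \<partial>lborel)"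
proof -
  interpret M: prob_space M by fact
  interpret pair_sigma_finite lborel M ..
  define S where "S = sym_cube - W ` sym_cube"
  have [measurable]: "S \<in> sets borel"
    using S by (simp add: S_def)
  obtain C where C: "\<And>A. A \<in> sets borel \<Longrightarrow> A \<subseteq> S \<Longrightarrow> occupation_intensity M X A \<le> ennreal C * emeasure lborel A"
    using \<open>bci M X W\<close> unfolding bci_def S_def by blast
  have X': "(\<lambda>z. X (fst z) (snd z)) \<in> borel_measurable (borel \<Otimes>\<^sub>M M)"
    using X by (simp add: case_prod_beta')
  have Y [measurable]: "(\<lambda>z. (fst z, X (fst z) (snd z))) \<in> borel_measurable (lborel \<Otimes>\<^sub>M M)"
    unfolding borel_prod[symmetric] using X' by measurable
  define \<nu> where "\<nu> = distr (lborel \<Otimes>\<^sub>M M) borel (\<lambda>z. (fst z, X (fst z) (snd z)))"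
  have [simp]: "sets \<nu> = sets borel"
    by (simp add: \<nu>_def)
  have [simp]: "f \<in> borel_measurable \<nu> \<longleftrightarrow> f \<in> borel_measurable borel"
    for f :: "(real^'d) \<times> (real^'m) \<Rightarrow> ennreal"
    using measurable_cong_sets[of \<nu> borel "borel :: ennreal measure" borel] by simp
  have le: "density \<nu> (indicator S) \<le> scale_measure (ennreal C) lborel"
  proof (subst le_measure)
    show "\<forall>A\<in>sets (density \<nu> (indicator S)). emeasure (density \<nu> (indicator S)) A \<le> emeasure (scale_measure (ennreal C) lborel) A"
    proof
      fix A assume "A \<in> sets (density \<nu> (indicator S))"
      then have A [measurable]: "A \<in> sets borel" by simp
      have "emeasure (density \<nu> (indicator S)) A = (\<integral>\<^sup>+z. indicator (S \<inter> A) z \<partial>\<nu>)"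
        by (simp add: emeasure_density indicator_inter_arith)
      also have "\<dots> = emeasure \<nu> (S \<inter> A)"
        by simp
      also have "\<dots> = occupation_intensity M X (S \<inter> A)"
        unfolding \<nu>_def by (rule emeasure_occupation_distr[OF \<open>prob_space M\<close> X]) simp
      also have "\<dots> \<le> ennreal C * emeasure lborel (S \<inter> A)"
        by (rule C) auto
      also have "\<dots> \<le> ennreal C * emeasure lborel A"
        by (intro mult_left_mono emeasure_mono) auto
      finally show "emeasure (density \<nu> (indicator S)) A \<le> emeasure (scale_measure (ennreal C) lborel) A"
        by simp
    qed
  qed simp
  show thesis
  proof (rule that[of C])
    fix f :: "(real^'d) \<times> (real^'m) \<Rightarrow> ennreal"
    assume [measurable]: "f \<in> borel_measurable borel"
    define g where "g z = indicator S z * f z" for z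
    have g [measurable]: "g \<in> borel_measurable borel"
      unfolding g_def by measurable
    have "(\<integral>\<^sup>+t. \<integral>\<^sup>+\<omega>. g (t, X t \<omega>) \<partial>M \<partial>lborel) = (\<integral>\<^sup>+z. g (fst z, X (fst z) (snd z)) \<partial>(lborel \<Otimes>\<^sub>M M))"
      using M.nn_integral_fst[of "\<lambda>z. g (fst z, X (fst z) (snd z))" lborel] by simp
    also have "\<dots> = (\<integral>\<^sup>+z. g z \<partial>\<nu>)"
      by (simp add: \<nu>_def nn_integral_distr)
    also have "\<dots> = (\<integral>\<^sup>+z. g z \<partial>density \<nu> (indicator S))"
      by (subst nn_integral_density) (auto intro!: nn_integral_cong simp: g_def indicator_def)
    also have "\<dots> \<le> (\<integral>\<^sup>+z. g z \<partial>scale_measure (ennreal C) lborel)"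
      using le by (intro nn_integral_mono_measure) auto
    also have "\<dots> = ennreal C * (\<integral>\<^sup>+z. g z \<partial>lborel)"
      by (rule nn_integral_scale_measure) simp
    finally show "(\<integral>\<^sup>+t. \<integral>\<^sup>+\<omega>. indicator (sym_cube - W ` sym_cube) (t, X t \<omega>) * f (t, X t \<omega>) \<partial>M \<partial>lborel)
      \<le> ennreal C * (\<integral>\<^sup>+z. indicator (sym_cube - W ` sym_cube) z * f z \<partial>lborel)"
      by (simp add: g_def S_def)
  qed
qed

text \<open>Fubini moves the expectation inside, where stationarity makes it a function of
  \<open>t - s\<close>. For each fixed \<open>s\<close> in the unit cube the differences lie in
  \<open>cbox (- 1) 1\<close>, and the average over \<open>s\<close> has total mass 1.\<close>

lemma stationary_energy_le:
  fixes X :: "real^'d \<Rightarrow> 'w \<Rightarrow> real^'m"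
  assumes "prob_space M" and X: "(\<lambda>(t, \<omega>). X t \<omega>) \<in> borel \<Otimes>\<^sub>M M \<rightarrow>\<^sub>M borel"
    and stat: "stationary_increments M X"
  defines "N \<equiv> restrict_space lborel (cbox (0 :: real^'d) 1)"
  shows "(\<integral>\<^sup>+\<omega>. \<integral>\<^sup>+z. riesz \<gamma> (X (fst z) \<omega> - X (snd z) \<omega>) \<partial>(N \<Otimes>\<^sub>M N) \<partial>M)
    \<le> (\<integral>\<^sup>+u. indicator (cbox (- 1) 1) u * (\<integral>\<^sup>+\<omega>. riesz \<gamma> (X u \<omega>) \<partial>M) \<partial>lborel)"
    and "prob_space N"
    and "(\<lambda>\<omega>. \<integral>\<^sup>+z. riesz \<gamma> (X (fst z) \<omega> - X (snd z) \<omega>) \<partial>(N \<Otimes>\<^sub>M N)) \<in> borel_measurable M"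
proof -
  interpret M: prob_space M by fact
  have unit: "emeasure lborel (cbox (0 :: real^'d) 1) = 1"
    by (simp add: emeasure_lborel_cbox_eq prod_Basis_cart) (auto simp: Basis_vec_def inner_axis)
  show "prob_space N"
    by (rule prob_spaceI) (simp add: N_def emeasure_restrict_space space_restrict_space unit)
  then interpret N: prob_space N .
  interpret NN: pair_prob_space N N ..
  interpret NNM: pair_sigma_finite "N \<Otimes>\<^sub>M N" M ..
  have id [measurable]: "(\<lambda>t. t) \<in> N \<rightarrow>\<^sub>M borel"
    unfolding N_def by (rule measurable_restrict_space1) simp
  have XM [measurable (raw)]: "(\<lambda>z. X (f z) (g z)) \<in> borel_measurable L"
    if "f \<in> L \<rightarrow>\<^sub>M borel" "g \<in> L \<rightarrow>\<^sub>M M" for f g and L :: "'z measure"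
    using measurable_compose[OF measurable_Pair[OF that] X] by simp
  define \<psi> where "\<psi> u = (\<integral>\<^sup>+\<omega>. riesz \<gamma> (X u \<omega>) \<partial>M)" for u
  have [measurable]: "\<psi> \<in> borel_measurable borel"
  proof -
    have "(\<lambda>z. riesz \<gamma> (X (fst z) (snd z))) \<in> borel_measurable (borel \<Otimes>\<^sub>M M)"
      by (intro measurable_compose[OF XM borel_measurable_riesz]) auto
    then show ?thesis
      unfolding \<psi>_def by (intro M.borel_measurable_nn_integral) (simp add: case_prod_beta')
  qed
  have X_t: "X t \<in> borel_measurable M" for t
    by (rule XM) auto
  have stat': "(\<integral>\<^sup>+\<omega>. riesz \<gamma> (X s \<omega> - X t \<omega>) \<partial>M) = \<psi> (t - s)" for s t
  proof -
    have "(\<integral>\<^sup>+\<omega>. riesz \<gamma> (X s \<omega> - X t \<omega>) \<partial>M) = (\<integral>\<^sup>+\<omega>. riesz \<gamma> (X t \<omega> - X s \<omega>) \<partial>M)"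
      by (intro nn_integral_cong) (simp add: riesz_def norm_minus_commute)
    also have "\<dots> = (\<integral>\<^sup>+x. riesz \<gamma> x \<partial>distr M borel (\<lambda>\<omega>. X t \<omega> - X s \<omega>))"
      using X_t by (simp add: nn_integral_distr)
    also have "\<dots> = (\<integral>\<^sup>+x. riesz \<gamma> x \<partial>distr M borel (X (t - s)))"
      using stat by (simp add: stationary_increments_def)
    also have "\<dots> = \<psi> (t - s)"
      using X_t by (simp add: nn_integral_distr \<psi>_def)
    finally show ?thesis .
  qed
  have meas: "(\<lambda>p. riesz \<gamma> (X (fst (fst p)) (snd p) - X (snd (fst p)) (snd p))) \<in> borel_measurable ((N \<Otimes>\<^sub>M N) \<Otimes>\<^sub>M M)"
  proof (rule measurable_compose[OF borel_measurable_diff borel_measurable_riesz])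
    show "(\<lambda>p. X (fst (fst p)) (snd p)) \<in> borel_measurable ((N \<Otimes>\<^sub>M N) \<Otimes>\<^sub>M M)"
      by (rule XM) measurable
    show "(\<lambda>p. X (snd (fst p)) (snd p)) \<in> borel_measurable ((N \<Otimes>\<^sub>M N) \<Otimes>\<^sub>M M)"
      by (rule XM) measurable
  qed
  show "(\<lambda>\<omega>. \<integral>\<^sup>+z. riesz \<gamma> (X (fst z) \<omega> - X (snd z) \<omega>) \<partial>(N \<Otimes>\<^sub>M N)) \<in> borel_measurable M"
    using measurable_compose[OF measurable_pair_swap' meas]
    by (intro NN.P.borel_measurable_nn_integral) (simp add: case_prod_beta')
  have "(\<integral>\<^sup>+\<omega>. \<integral>\<^sup>+z. riesz \<gamma> (X (fst z) \<omega> - X (snd z) \<omega>) \<partial>(N \<Otimes>\<^sub>M N) \<partial>M)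
    = (\<integral>\<^sup>+z. \<integral>\<^sup>+\<omega>. riesz \<gamma> (X (fst z) \<omega> - X (snd z) \<omega>) \<partial>M \<partial>(N \<Otimes>\<^sub>M N))"
    by (rule NNM.Fubini') (use meas in \<open>simp add: case_prod_beta'\<close>)
  also have "\<dots> = (\<integral>\<^sup>+z. \<psi> (snd z - fst z) \<partial>(N \<Otimes>\<^sub>M N))"
    by (simp add: stat')
  also have "\<dots> = (\<integral>\<^sup>+s. \<integral>\<^sup>+t. \<psi> (t - s) \<partial>N \<partial>N)"
    using N.nn_integral_fst[of "\<lambda>z. \<psi> (snd z - fst z)" N] by simp
  also have "\<dots> \<le> (\<integral>\<^sup>+s. (\<integral>\<^sup>+u. indicator (cbox (- 1) 1) u * \<psi> u \<partial>lborel) \<partial>N)"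
  proof (rule nn_integral_mono)
    fix s assume "s \<in> space N"
    then have s: "s \<in> cbox 0 1"
      by (simp add: N_def space_restrict_space)
    have "(\<integral>\<^sup>+t. \<psi> (t - s) \<partial>N) = (\<integral>\<^sup>+t. \<psi> (t - s) * indicator (cbox 0 1) t \<partial>lborel)"
      unfolding N_def by (rule nn_integral_restrict_space) simp
    also have "\<dots> = (\<integral>\<^sup>+t. \<psi> ((t + s) - s) * indicator (cbox 0 1) (t + s) \<partial>lborel)"
      by (rule nn_integral_lborel_translation[symmetric]) measurable
    also have "\<dots> \<le> (\<integral>\<^sup>+u. indicator (cbox (- 1) 1) u * \<psi> u \<partial>lborel)"
    proof (rule nn_integral_mono)
      fix t :: "real^'d"
      have "t \<in> cbox (- 1) 1" if "t + s \<in> cbox 0 1"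
      proof -
        have "- 1 \<le> t $ i \<and> t $ i \<le> 1" for i
        proof -
          have "0 \<le> t $ i + s $ i" "t $ i + s $ i \<le> 1" "0 \<le> s $ i" "s $ i \<le> 1"
            using that s by (simp_all add: mem_box_cart)
          then show ?thesis by linarith
        qed
        then show ?thesis by (simp add: mem_box_cart)
      qed
      then show "\<psi> ((t + s) - s) * indicator (cbox 0 1) (t + s) \<le> indicator (cbox (- 1) 1) t * \<psi> t"
        by (simp add: indicator_def)
    qed
    finally show "(\<integral>\<^sup>+t. \<psi> (t - s) \<partial>N) \<le> (\<integral>\<^sup>+u. indicator (cbox (- 1) 1) u * \<psi> u \<partial>lborel)" .
  qed
  also have "\<dots> = (\<integral>\<^sup>+u. indicator (cbox (- 1) 1) u * \<psi> u \<partial>lborel)"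
    by (simp add: N.emeasure_space_1)
  finally show "(\<integral>\<^sup>+\<omega>. \<integral>\<^sup>+z. riesz \<gamma> (X (fst z) \<omega> - X (snd z) \<omega>) \<partial>(N \<Otimes>\<^sub>M N) \<partial>M)
    \<le> (\<integral>\<^sup>+u. indicator (cbox (- 1) 1) u * (\<integral>\<^sup>+\<omega>. riesz \<gamma> (X u \<omega>) \<partial>M) \<partial>lborel)"
    by (simp add: \<psi>_def)
qed

section \<open>Decomposition into shells and the expected Riesz kernel\<close>

lemma eq_0_if_le_geometric:
  fixes x :: "'a::real_normed_vector"
  assumes "0 < r" "r < 1" "\<And>n. norm x \<le> K * r ^ n"
  shows "x = 0"
proof -
  have "(\<lambda>n. K * r ^ n) \<longlonglongrightarrow> K * 0"
    using assms(1,2) by (intro tendsto_mult_left LIMSEQ_realpow_zero) auto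
  then have "norm x \<le> K * 0"
    using assms(3) by (intro LIMSEQ_le_const) auto
  then show ?thesis by simp
qed

lemma norm_le_card_if_mem_cbox:
  fixes x :: "real^'n"
  assumes "x \<in> cbox (- 1) 1"
  shows "norm x \<le> CARD('n)"
proof -
  have "\<bar>x $ i\<bar> \<le> 1" for i
    using assms by (simp add: mem_box_cart abs_le_iff minus_le_iff)
  then have "(\<Sum>i\<in>UNIV. \<bar>x $ i\<bar>) \<le> (\<Sum>i\<in>(UNIV :: 'n set). 1)"
    by (intro sum_mono)
  then show ?thesis
    using norm_le_l1_cart[of x] by simp
qed

lemma riesz_le_1_if_not_mem_cbox:
  fixes x :: "real^'n"
  assumes "x \<notin> cbox (- 1) 1" "0 \<le> \<gamma>"
  shows "riesz \<gamma> x \<le> 1"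
proof -
  obtain i where "x $ i < - 1 \<or> 1 < x $ i"
    using assms(1) by (auto simp: mem_box_cart not_le)
  then have "\<bar>x $ i\<bar> > 1"
    by auto
  then have "norm x > 1"
    using component_le_norm_cart[of x i] by linarith
  then show ?thesis
    using assms(2) by (auto simp: riesz_def ennreal_le_1 powr_minus inverse_le_1_iff ge_one_powr_ge_zero)
qed

text \<open>A graph point over \<open>u \<noteq> 0\<close> in the cube lies in the image of the
  shell \<open>S\<close> under some power of \<open>W\<close>. On the part belonging to
  \<open>n\<close>, substituting \<open>u\<close> by \<open>U\<close> applied \<open>n\<close> times
  to \<open>v\<close> yields the factor \<open>\<bar>det U\<bar> ^ n\<close>, self-affinity replaces
  the field by \<open>V\<close> applied \<open>n\<close> times to \<open>X v\<close>, and the b.c.i.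
  condition passes to Lebesgue measure on \<open>S\<close>. Points with \<open>X u\<close> outside
  the cube contribute at most 1.\<close>

lemma expected_riesz_finite:
  fixes X :: "real^'d \<Rightarrow> 'w \<Rightarrow> real^'m" and U :: "real^'d^'d" and V :: "real^'m^'m"
  assumes "prob_space M" and X: "(\<lambda>(t, \<omega>). X t \<omega>) \<in> borel \<Otimes>\<^sub>M M \<rightarrow>\<^sub>M borel"
    and bci: "bci M X (block_diag U V)"
    and affine: "\<And>t. distr M borel (X (U *v t)) = distr M borel (\<lambda>\<omega>. V *v X t \<omega>)"
    and inv: "invertible U" "invertible V"
    and U: "0 < r" "r < 1" "\<And>n x. norm ((((*v) U) ^^ n) x) \<le> K * r ^ n * norm x"
    and V: "0 < r'" "r' < 1" "\<And>n x. norm ((((*v) V) ^^ n) x) \<le> K' * r' ^ n * norm x"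
    and \<gamma>: "0 \<le> \<gamma>"
    and fin: "(\<Sum>n. ennreal (\<bar>det U\<bar> ^ n) *
      (\<integral>\<^sup>+x. indicator (cbox (- 1) 1) x * riesz \<gamma> ((((*v) V) ^^ n) x) \<partial>lborel)) < \<infinity>"
  shows "(\<integral>\<^sup>+u. indicator (cbox (- 1) 1) u * (\<integral>\<^sup>+\<omega>. riesz \<gamma> (X u \<omega>) \<partial>M) \<partial>lborel) < \<infinity>"
proof -
  interpret M: prob_space M by fact
  interpret LM: pair_sigma_finite lborel M ..
  obtain U' where U': "U ** U' = mat 1" "U' ** U = mat 1"
    using inv(1) by (auto simp: invertible_def)
  obtain V' where V': "V ** V' = mat 1" "V' ** V = mat 1"
    using inv(2) by (auto simp: invertible_def)
  have cancel: "(((*v) A) ^^ n) ((((*v) B) ^^ n) x) = x" if "A ** B = mat 1" for A B :: "real^'k^'k" and n x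
  proof (induction n arbitrary: x)
    case (Suc n)
    have "(((*v) A) ^^ Suc n) ((((*v) B) ^^ Suc n) x) = (((*v) A) ^^ n) (A *v (B *v (((*v) B) ^^ n) x))"
      by (simp only: funpow_Suc_right[of n "(*v) A"] o_apply funpow.simps(2)[of n "(*v) B"])
    then show ?case
      using Suc that by (simp add: matrix_vector_mul_assoc)
  qed simp
  define W where "W = block_diag U V"
  define S where "S = sym_cube - W ` sym_cube"
  \<comment> \<open>\<open>\<phi> n\<close> is the inverse of the \<open>n\<close>-th iterate of
    \<open>W\<close>.\<close>
  define \<phi> where "\<phi> n = (\<lambda>(u, x). ((((*v) U') ^^ n) u, (((*v) V') ^^ n) x))" for n
  have sets_S: "S \<in> sets borel"
  proof -
    have "continuous_on sym_cube W"
    proof -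
      have "bounded_linear ((*v) A)" for A :: "real^'k^'k"
        by (simp add: linear_conv_bounded_linear[symmetric] matrix_vector_mul_linear)
      note cont = bounded_linear.continuous_on[OF this]
      show ?thesis
        unfolding W_def block_diag_def case_prod_beta'
        by (intro continuous_intros cont)
    qed
    moreover have "compact (sym_cube :: ((real^'d) \<times> (real^'m)) set)"
      unfolding sym_cube_def by (intro compact_Times compact_cbox)
    ultimately have "compact (W ` sym_cube)" "compact (sym_cube :: ((real^'d) \<times> (real^'m)) set)"
      by (auto intro: compact_continuous_image)
    then show ?thesis
      unfolding S_def by (intro sets.Diff borel_closed compact_imp_closed)
  qed
  note [measurable] = sets_S
  have mem_W: "z \<in> W ` sym_cube \<longleftrightarrow> \<phi> 1 z \<in> sym_cube" for z
  proof -
    have "W (\<phi> 1 z) = z" "\<phi> 1 (W z) = z"  for z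
      by (auto simp: W_def \<phi>_def block_diag_def matrix_vector_mul_assoc U' V' split: prod.splits)
    then show ?thesis by (metis image_iff)
  qed
  \<comment> \<open>A point missed by all shells would stay in the cube under every
    \<open>\<phi> n\<close>; contraction of \<open>U\<close> then forces its first component to be
    0.\<close>
  have cover: "\<exists>n. \<phi> n z \<in> S" if "z \<in> sym_cube" "fst z \<noteq> 0" for z
  proof (rule ccontr)
    assume "\<nexists>n. \<phi> n z \<in> S"
    have "\<phi> n z \<in> sym_cube" for n
    proof (induction n)
      case 0
      then show ?case using that(1) by (simp add: \<phi>_def case_prod_beta)
    next
      case (Suc n)
      then have "\<phi> n z \<in> W ` sym_cube"
        using \<open>\<nexists>n. \<phi> n z \<in> S\<close> by (auto simp: S_def)
      moreover have "\<phi> 1 (\<phi> n z) = \<phi> (Suc n) z"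
        by (simp add: \<phi>_def case_prod_beta)
      ultimately show ?case
        using mem_W by metis
    qed
    then have "(((*v) U') ^^ n) (fst z) \<in> cbox (- 1) 1" for n
      by (auto simp: \<phi>_def sym_cube_def case_prod_beta)
    then have le: "norm ((((*v) U') ^^ n) (fst z)) \<le> CARD('d)" for n
      by (rule norm_le_card_if_mem_cbox)
    \<comment> \<open>\<open>K\<close> comes without a sign, so the maximum with 0 is taken before
      multiplying bounds.\<close>
    have "norm (fst z) \<le> (max K 0 * CARD('d)) * r ^ n" for n
    proof -
      have "norm (fst z) \<le> K * r ^ n * norm ((((*v) U') ^^ n) (fst z))"
        using U(3)[of n "(((*v) U') ^^ n) (fst z)"] by (simp add: cancel[OF U'(1)])
      also have "\<dots> \<le> max K 0 * r ^ n * CARD('d)"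
        using U(1) le[of n] by (intro mult_mono) auto
      finally show ?thesis by (simp add: mult_ac)
    qed
    then show False
      using eq_0_if_le_geometric[OF U(1,2)] that(2) by blast
  qed
  have XM: "(\<lambda>z. X (f z) (g z)) \<in> borel_measurable L"
    if "f \<in> L \<rightarrow>\<^sub>M borel" "g \<in> L \<rightarrow>\<^sub>M M" for f g and L :: "'z measure"
    using measurable_compose[OF measurable_Pair[OF that] X] by simp
  have X_t [measurable]: "X t \<in> borel_measurable M" for t
    by (rule XM) auto
  have affine_n: "distr M borel (X ((((*v) U) ^^ n) t)) = distr M borel (\<lambda>\<omega>. (((*v) V) ^^ n) (X t \<omega>))" for n t
  proof (induction n)
    case (Suc n)
    have [measurable]: "(*v) V \<in> borel_measurable borel"
      using borel_measurable_matrix_funpow[of 1 V] by simp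
    have "distr M borel (X ((((*v) U) ^^ Suc n) t)) = distr M borel (\<lambda>\<omega>. V *v X ((((*v) U) ^^ n) t) \<omega>)"
      using affine by simp
    also have "\<dots> = distr (distr M borel (X ((((*v) U) ^^ n) t))) borel ((*v) V)"
      by (subst distr_distr) (auto simp: comp_def)
    also have "\<dots> = distr M borel (\<lambda>\<omega>. (((*v) V) ^^ Suc n) (X t \<omega>))"
      unfolding Suc by (subst distr_distr) (auto simp: comp_def)
    finally show ?case .
  qed simp
  obtain C where C: "\<And>f. f \<in> borel_measurable borel \<Longrightarrow>
    (\<integral>\<^sup>+t. \<integral>\<^sup>+\<omega>. indicator S (t, X t \<omega>) * f (t, X t \<omega>) \<partial>M \<partial>lborel)
    \<le> ennreal C * (\<integral>\<^sup>+z. indicator S z * f z \<partial>lborel)"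
    using bci_nn_integral[OF \<open>prob_space M\<close> X bci] sets_S unfolding S_def W_def by blast
  define J where "J n = (\<integral>\<^sup>+x. indicator (cbox (- 1) 1) x * riesz \<gamma> ((((*v) V) ^^ n) x) \<partial>lborel)" for n
  define vol where "vol = emeasure lborel (cbox (- 1) 1 :: (real^'d) set)"
  have vol: "vol < \<infinity>"
    unfolding vol_def by (rule emeasure_lborel_cbox_finite)
  define g where "g n u \<omega> = indicator S (\<phi> n (u, X u \<omega>)) * riesz \<gamma> (X u \<omega>)" for n u \<omega>
  have \<phi>_meas [measurable]: "\<phi> n \<in> borel \<rightarrow>\<^sub>M borel" for n
    unfolding \<phi>_def borel_prod[symmetric] by measurable
  have XP [measurable]: "(\<lambda>z. (fst z, X (fst z) (snd z))) \<in> lborel \<Otimes>\<^sub>M M \<rightarrow>\<^sub>M borel"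
  proof -
    have "(\<lambda>z. X (fst z) (snd z)) \<in> borel_measurable (lborel \<Otimes>\<^sub>M M)"
      by (rule XM) auto
    then show ?thesis
      unfolding borel_prod[symmetric] by measurable
  qed
  have XP2 [measurable]: "(\<lambda>z. X (fst z) (snd z)) \<in> lborel \<Otimes>\<^sub>M M \<rightarrow>\<^sub>M borel"
    by (rule XM) auto
  have g_meas: "(\<lambda>z. g n (fst z) (snd z)) \<in> borel_measurable (lborel \<Otimes>\<^sub>M M)" for n
    unfolding g_def by (intro borel_measurable_times_ennreal measurable_compose[OF XP] measurable_compose[OF XP2]) measurable
  have g_meas_t: "(\<lambda>u. \<integral>\<^sup>+\<omega>. g n u \<omega> \<partial>M) \<in> borel_measurable lborel" for n
    using g_meas[of n] by (intro M.borel_measurable_nn_integral) (simp add: case_prod_beta')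
  have g_meas_\<omega>: "g n u \<in> borel_measurable M" for n u
    using measurable_compose[OF measurable_Pair1'[of u lborel M] g_meas[of n]] by simp
  have scaling: "(\<integral>\<^sup>+u. \<integral>\<^sup>+\<omega>. g n u \<omega> \<partial>M \<partial>lborel) \<le> ennreal C * vol * (ennreal (\<bar>det U\<bar> ^ n) * J n)" for n
  proof -
    have "det U \<noteq> 0"
      using inv(1) by (simp add: invertible_det_nz)
    then have "(\<integral>\<^sup>+u. \<integral>\<^sup>+\<omega>. g n u \<omega> \<partial>M \<partial>lborel)
      = ennreal (\<bar>det U\<bar> ^ n) * (\<integral>\<^sup>+v. \<integral>\<^sup>+\<omega>. g n ((((*v) U) ^^ n) v) \<omega> \<partial>M \<partial>lborel)"
      using g_meas_t by (intro nn_integral_lborel_funpow) auto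
    also have "(\<integral>\<^sup>+v. \<integral>\<^sup>+\<omega>. g n ((((*v) U) ^^ n) v) \<omega> \<partial>M \<partial>lborel)
      = (\<integral>\<^sup>+v. \<integral>\<^sup>+\<omega>. indicator S (v, X v \<omega>) * riesz \<gamma> ((((*v) V) ^^ n) (X v \<omega>)) \<partial>M \<partial>lborel)"
    proof (rule nn_integral_cong)
      fix v :: "real^'d"
      \<comment> \<open>For fixed \<open>v\<close> the integrand depends on the field only through
        its value at one point, so the law of that value may be exchanged.\<close>
      define k where "k x = indicator S (v, (((*v) V') ^^ n) x) * riesz \<gamma> x" for x
      have [measurable]: "k \<in> borel_measurable borel"
      proof -
        have [measurable]: "(\<lambda>x. (v, (((*v) V') ^^ n) x)) \<in> borel \<rightarrow>\<^sub>M borel"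
          unfolding borel_prod[symmetric] by measurable
        show ?thesis unfolding k_def by measurable
      qed
      have "(\<integral>\<^sup>+\<omega>. g n ((((*v) U) ^^ n) v) \<omega> \<partial>M) = (\<integral>\<^sup>+\<omega>. k (X ((((*v) U) ^^ n) v) \<omega>) \<partial>M)"
        by (simp add: g_def k_def \<phi>_def cancel[OF U'(2)])
      also have "\<dots> = (\<integral>\<^sup>+x. k x \<partial>distr M borel (X ((((*v) U) ^^ n) v)))"
        by (simp add: nn_integral_distr)
      also have "\<dots> = (\<integral>\<^sup>+\<omega>. k ((((*v) V) ^^ n) (X v \<omega>)) \<partial>M)"
        unfolding affine_n by (subst nn_integral_distr) auto
      finally show "(\<integral>\<^sup>+\<omega>. g n ((((*v) U) ^^ n) v) \<omega> \<partial>M)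
        = (\<integral>\<^sup>+\<omega>. indicator S (v, X v \<omega>) * riesz \<gamma> ((((*v) V) ^^ n) (X v \<omega>)) \<partial>M)"
        by (simp add: k_def cancel[OF V'(2)])
    qed
    also have "ennreal (\<bar>det U\<bar> ^ n) * \<dots> \<le> ennreal (\<bar>det U\<bar> ^ n) * (ennreal C * (\<integral>\<^sup>+z. indicator S z * riesz \<gamma> ((((*v) V) ^^ n) (snd z)) \<partial>lborel))"
    proof -
      have "(\<lambda>z. riesz \<gamma> ((((*v) V) ^^ n) (snd z))) \<in> borel_measurable (borel :: ((real^'d) \<times> (real^'m)) measure)"
        unfolding borel_prod[symmetric] by measurable
      then show ?thesis
        using C[of "\<lambda>z. riesz \<gamma> ((((*v) V) ^^ n) (snd z))"] by (intro mult_left_mono) simp_all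
    qed
    also have "\<dots> \<le> ennreal (\<bar>det U\<bar> ^ n) * (ennreal C * (vol * J n))"
    proof (intro mult_left_mono)
      have "(\<integral>\<^sup>+z. indicator S z * riesz \<gamma> ((((*v) V) ^^ n) (snd z)) \<partial>lborel)
        \<le> (\<integral>\<^sup>+z. indicator (cbox (- 1) 1) (fst z :: real^'d) *
          (indicator (cbox (- 1) 1) (snd z) * riesz \<gamma> ((((*v) V) ^^ n) (snd z))) \<partial>lborel)"
        by (intro nn_integral_mono) (auto simp: S_def sym_cube_def indicator_def)
      also have "\<dots> = (\<integral>\<^sup>+v. \<integral>\<^sup>+x. indicator (cbox (- 1) 1) (v :: real^'d) *
          (indicator (cbox (- 1) 1) x * riesz \<gamma> ((((*v) V) ^^ n) x)) \<partial>lborel \<partial>lborel)"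
        unfolding lborel_prod[symmetric] by (subst lborel.nn_integral_fst[symmetric]) auto
      also have "\<dots> = vol * J n"
        by (simp add: nn_integral_cmult nn_integral_multc J_def vol_def)
      finally show "(\<integral>\<^sup>+z. indicator S z * riesz \<gamma> ((((*v) V) ^^ n) (snd z)) \<partial>lborel) \<le> vol * J n" .
    qed auto
    finally show ?thesis
      by (simp add: mult_ac)
  qed
  have "(\<integral>\<^sup>+u. indicator (cbox (- 1) 1) u * (\<integral>\<^sup>+\<omega>. riesz \<gamma> (X u \<omega>) \<partial>M) \<partial>lborel)
    \<le> (\<integral>\<^sup>+u. indicator (cbox (- 1) 1) u + (\<Sum>n. \<integral>\<^sup>+\<omega>. g n u \<omega> \<partial>M) \<partial>lborel)"
  proof (rule nn_integral_mono_AE)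
    have "AE u in lborel. u \<noteq> (0 :: real^'d)"
      by (rule AE_lborel_singleton)
    then show "AE u in lborel. indicator (cbox (- 1) 1) u * (\<integral>\<^sup>+\<omega>. riesz \<gamma> (X u \<omega>) \<partial>M)
      \<le> indicator (cbox (- 1) 1) u + (\<Sum>n. \<integral>\<^sup>+\<omega>. g n u \<omega> \<partial>M)"
    proof eventually_elim
      case (elim u)
      show ?case
      proof (cases "u \<in> cbox (- 1) 1")
        case True
        have "(\<integral>\<^sup>+\<omega>. riesz \<gamma> (X u \<omega>) \<partial>M) \<le> (\<integral>\<^sup>+\<omega>. 1 + (\<Sum>n. g n u \<omega>) \<partial>M)"
        proof (rule nn_integral_mono)
          fix \<omega>
          show "riesz \<gamma> (X u \<omega>) \<le> 1 + (\<Sum>n. g n u \<omega>)"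
          proof (cases "X u \<omega> \<in> cbox (- 1) 1")
            case False
            then show ?thesis
              using riesz_le_1_if_not_mem_cbox[OF False \<gamma>] by (meson add_increasing2 zero_le)
          next
            case x: True
            then obtain n where "\<phi> n (u, X u \<omega>) \<in> S"
              using cover[of "(u, X u \<omega>)"] True elim by (auto simp: sym_cube_def)
            then have "riesz \<gamma> (X u \<omega>) = g n u \<omega>"
              by (simp add: g_def)
            also have "\<dots> \<le> (\<Sum>n. g n u \<omega>)"
              using sum_le_suminf[of "\<lambda>n. g n u \<omega>" "{n}"] by simp
            finally show ?thesis
              by (meson add_increasing zero_le)
          qed
        qed
        also have "\<dots> = 1 + (\<Sum>n. \<integral>\<^sup>+\<omega>. g n u \<omega> \<partial>M)"
          using g_meas_\<omega> by (simp add: nn_integral_add nn_integral_suminf M.emeasure_space_1)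
        finally show ?thesis
          using True by simp
      qed simp
    qed
  qed
  also have "\<dots> = vol + (\<Sum>n. \<integral>\<^sup>+u. \<integral>\<^sup>+\<omega>. g n u \<omega> \<partial>M \<partial>lborel)"
    using g_meas_t by (simp add: nn_integral_add nn_integral_suminf vol_def)
  also have "\<dots> \<le> vol + (\<Sum>n. ennreal C * vol * (ennreal (\<bar>det U\<bar> ^ n) * J n))"
    using scaling by (intro add_left_mono suminf_le) auto
  also have "\<dots> = vol + ennreal C * vol * (\<Sum>n. ennreal (\<bar>det U\<bar> ^ n) * J n)"
    by simp
  also have "\<dots> < \<infinity>"
    using fin vol by (auto simp: J_def ennreal_mult_less_top)
  finally show ?thesis .
qed

section \<open>From finite energies to the dimension bound\<close>

lemma hausdorff_dim_ge_if_energies_finite: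
  fixes X :: "'a \<Rightarrow> 'b::euclidean_space"
  assumes "prob_space N" "X \<in> borel_measurable N" and pos: "\<And>n. 0 < \<gamma> n" and lim: "\<gamma> \<longlonglongrightarrow> s"
    and fin: "\<And>n. (\<integral>\<^sup>+z. riesz (\<gamma> n) (X (fst z) - X (snd z)) \<partial>(N \<Otimes>\<^sub>M N)) < \<infinity>"
  shows "ereal s \<le> hausdorff_dim (X ` space N)"
  unfolding hausdorff_dim_def
proof (rule Inf_greatest, clarify)
  fix s' :: real assume s': "0 \<le> s'" "hausdorff_measure s' (X ` space N) = 0"
  \<comment> \<open>If \<open>s'\<close> were below \<open>\<gamma> n\<close>, finite energy at
    \<open>\<gamma> n\<close> would make the measure at \<open>s'\<close> nonzero. Passing to the
    limit never asks for finite energy at \<open>s\<close> itself.\<close>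
  have "\<gamma> n \<le> s'" for n
    using finite_energy_imp_hausdorff_measure_neq_0[OF assms(1,2) fin[of n] pos[of n], of s'] s'
    by (meson linear)
  then show "ereal s \<le> ereal s'"
    using LIMSEQ_le_const2[OF lim] by auto
qed

lemma trace_pos:
  fixes E :: "real^'n^'n"
  assumes "\<And>z. ceigenvalue E z \<Longrightarrow> 0 < Re z"
  shows "0 < trace E"
proof -
  obtain P Q B :: "complex^'n^'n" and h :: "'n \<Rightarrow> nat" where
    PQ: "P ** Q = mat 1" "Q ** P = mat 1" and E: "cmat E = P ** B ** Q" and h: "inj h" "upper_tri h B"
    using complex_triangularization[of "cmat E"] by metis
  have "trace E = Re (complex_of_real (trace E))"
    by simp
  also have "\<dots> = (\<Sum>i\<in>UNIV. Re (B$i$i))"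
    unfolding trace_triangular[OF E PQ(2)] by simp
  finally have "trace E = (\<Sum>i\<in>UNIV. Re (B$i$i))" .
  moreover have "Re (B$i$i) > 0" for i
    using assms ceigenvalue_triangular[OF E PQ(1) h(2,1)] by blast
  ultimately show ?thesis
    by (simp add: sum_pos)
qed

theorem theorem3p6:
  fixes M :: "'w measure"
    and E :: "real^'d^'d" and D :: "real^'m^'m"
    and c q :: real
    and X :: "real^'d \<Rightarrow> 'w \<Rightarrow> real^'m"
    and p :: nat and lam :: "nat \<Rightarrow> real" and mu :: "nat \<Rightarrow> nat"
  assumes "prob_space M"
    and "\<And>z. ceigenvalue E z \<Longrightarrow> 0 < Re z"
    and "\<And>z. ceigenvalue D z \<Longrightarrow> 0 < Re z"
    and "0 < c" and "c < 1"
    and "self_affine M (mat_powr c E) (mat_powr c D) X"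
    and "bci M X (block_diag (mat_powr c E) (mat_powr c D))"
    and "q = trace E"
    and "strict_mono_on {1..p} lam"
    and "lam ` {1..p} = Re ` {z. ceigenvalue D z}"
    and "\<And>i. i \<in> {1..p} \<Longrightarrow> mu i = re_multiplicity D (lam i)"
  shows "AE \<omega> in M.
    hausdorff_dim ((\<lambda>t. X t \<omega>) ` cbox 0 1) \<ge> ereal (sdim CARD('m) lam mu p q)"
proof -
  define U where "U = mat_powr c E"
  define V where "V = mat_powr c D"
  define s where "s = sdim CARD('m) lam mu p q"
  define N where "N = restrict_space lborel (cbox (0 :: real^'d) 1)"
  interpret prob_space M by fact
  have inv: "invertible U" "invertible V" and fdd: "same_fdd M (\<lambda>t. X (U *v t)) (\<lambda>t \<omega>. V *v X t \<omega>)"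
    and stat: "stationary_increments M X" and X: "(\<lambda>(t, \<omega>). X t \<omega>) \<in> borel \<Otimes>\<^sub>M M \<rightarrow>\<^sub>M borel"
    using assms(6) by (simp_all add: self_affine_def U_def V_def)
  note energy_le = stationary_energy_le[OF assms(1) X stat, folded N_def]
  have X_t [measurable]: "X t \<in> borel_measurable M" for t
    using measurable_compose[OF measurable_Pair1'[of t borel M] X] by simp
  have X_\<omega>: "(\<lambda>t. X t \<omega>) \<in> borel_measurable N" if "\<omega> \<in> space M" for \<omega>
    using measurable_compose[OF measurable_Pair2'[OF that] X] unfolding N_def
    by (intro measurable_restrict_space1) simp
  have affine: "distr M borel (X (U *v t)) = distr M borel (\<lambda>\<omega>. V *v X t \<omega>)" for t
  proof (rule same_fdd_imp_distr_eq[OF fdd])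
    have "(*v) V \<in> borel_measurable borel"
      using borel_measurable_matrix_funpow[of 1 V] by simp
    then show "(\<lambda>\<omega>. V *v X t \<omega>) \<in> borel_measurable M"
      by (rule measurable_compose[OF X_t])
  qed (rule X_t)
  obtain K r where U: "0 < r" "r < 1" "\<And>n x. norm ((((*v) U) ^^ n) x) \<le> K * r ^ n * norm x"
    unfolding U_def by (rule mat_powr_contracts[of E c]) (erule assms(2), rule assms(4), rule assms(5), rule that[unfolded U_def])
  obtain K' r' where V: "0 < r'" "r' < 1" "\<And>n x. norm ((((*v) V) ^^ n) x) \<le> K' * r' ^ n * norm x"
    unfolding V_def by (rule mat_powr_contracts[of D c]) (erule assms(3), rule assms(4), rule assms(5), rule that[unfolded V_def])
  obtain T :: "real^'m^'m" and \<kappa> :: "'m \<Rightarrow> real" where T: "det T \<noteq> 0"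
    and mult: "\<And>r. card {i. \<kappa> i = r} = re_multiplicity D r"
    and range: "range \<kappa> = Re ` {z. ceigenvalue D z}"
    and expand: "\<And>\<epsilon>. \<epsilon> > 0 \<Longrightarrow> \<exists>K>0. \<forall>n x i.
       \<bar>(T *v x)$i\<bar> \<le> K * c powr (- (real n * (\<kappa> i + \<epsilon>))) * norm ((((*v) V) ^^ n) x)"
    unfolding V_def by (rule mat_powr_expansion_coordinates[OF inv(2)[unfolded V_def] assms(4,5)]) (rule that[unfolded V_def])
  have \<kappa>: "\<kappa> j > 0" for j
    using range assms(3) by (metis (mono_tags, lifting) imageE mem_Collect_eq rangeI)
  have q: "q > 0"
    using trace_pos[of E] assms(2,8) by simp
  have energy: "AE \<omega> in M. (\<integral>\<^sup>+z. riesz \<gamma> (X (fst z) \<omega> - X (snd z) \<omega>) \<partial>(N \<Otimes>\<^sub>M N)) < \<infinity>"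
    if \<gamma>: "0 < \<gamma>" "\<gamma> < s" for \<gamma>
  proof -
    obtain \<eta> :: "'m \<Rightarrow> real" where \<eta>: "\<And>j. 0 \<le> \<eta> j" "\<And>j. \<eta> j < 1"
      "(\<Sum>j\<in>UNIV. \<eta> j) = \<gamma>" "(\<Sum>j\<in>UNIV. \<kappa> j * \<eta> j) < q"
    proof (rule sdim_weights[of p lam \<kappa> mu q \<gamma>])
      show "range \<kappa> = lam ` {1..p}"
        unfolding range assms(10) ..
      show "mu i = card {j. \<kappa> j = lam i}" if "i \<in> {1..p}" for i
        using assms(11)[OF that] by (simp add: mult)
    qed (use \<gamma> s_def \<kappa> q assms(9) in auto)
    \<comment> \<open>With this choice \<open>a\<close> is the midpoint between the total cost of
      \<open>\<eta>\<close> and \<open>q\<close>.\<close>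
    define \<epsilon> where "\<epsilon> = (q - (\<Sum>j\<in>UNIV. \<kappa> j * \<eta> j)) / (2 * \<gamma>)"
    define a where "a = (\<Sum>j\<in>UNIV. \<kappa> j * \<eta> j) + \<epsilon> * \<gamma>"
    have "\<epsilon> > 0"
      using \<eta>(4) \<gamma> by (simp add: \<epsilon>_def)
    then obtain L where L: "L > 0" "\<And>n x i.
        \<bar>(T *v x)$i\<bar> \<le> L * c powr (- (real n * (\<kappa> i + \<epsilon>))) * norm ((((*v) V) ^^ n) x)"
      using expand by blast
    obtain C where C: "0 \<le> C" "\<And>n. (\<integral>\<^sup>+x. indicator (cbox (- 1) 1) x * riesz \<gamma> ((((*v) V) ^^ n) x) \<partial>lborel)
        \<le> ennreal (C * c powr (- (real n * a)))"
      unfolding a_def by (rule nn_integral_riesz_linear_images[OF T assms(4) L \<eta>(1,2,3)]) (rule that[unfolded a_def])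
    have "a < q"
      using \<eta>(4) \<gamma> by (simp add: a_def \<epsilon>_def field_simps)
    \<comment> \<open>The factor \<open>c powr (q * real n)\<close> from the determinant outweighs
      the growth \<open>c powr (- (real n * a))\<close>, leaving a convergent geometric series of
      ratio \<open>\<rho>\<close>.\<close>
    define \<rho> where "\<rho> = c powr (q - a)"
    have \<rho>: "0 \<le> \<rho>" "\<rho> < 1"
      using \<open>a < q\<close> assms(4,5) powr_less_mono'[of c 0 "q - a"] by (simp_all add: \<rho>_def)
    have det_pow: "\<bar>det U\<bar> ^ n = c powr (q * real n)" for n
      using assms(4,8) by (simp add: U_def det_mat_powr powr_realpow[symmetric] powr_powr)
    have "(\<Sum>n. ennreal (\<bar>det U\<bar> ^ n) * (\<integral>\<^sup>+x. indicator (cbox (- 1) 1) x * riesz \<gamma> ((((*v) V) ^^ n) x) \<partial>lborel))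
      \<le> (\<Sum>n. ennreal (C * \<rho> ^ n))"
    proof (intro suminf_le)
      fix n
      have "\<bar>det U\<bar> ^ n * (C * c powr (- (real n * a))) = C * \<rho> ^ n"
        using assms(4) by (simp add: det_pow \<rho>_def powr_realpow[symmetric] powr_powr powr_add[symmetric] algebra_simps)
      moreover have "ennreal (\<bar>det U\<bar> ^ n) * ennreal (C * c powr (- (real n * a)))
        = ennreal (\<bar>det U\<bar> ^ n * (C * c powr (- (real n * a))))"
        using C(1) by (intro ennreal_mult[symmetric]) auto
      ultimately have "ennreal (\<bar>det U\<bar> ^ n) * ennreal (C * c powr (- (real n * a))) = ennreal (C * \<rho> ^ n)"
        by (simp only:)
      then show "ennreal (\<bar>det U\<bar> ^ n) * (\<integral>\<^sup>+x. indicator (cbox (- 1) 1) x * riesz \<gamma> ((((*v) V) ^^ n) x) \<partial>lborel)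
        \<le> ennreal (C * \<rho> ^ n)"
        using mult_left_mono[OF C(2)[of n], of "ennreal (\<bar>det U\<bar> ^ n)"] by simp
    qed auto
    also have "\<dots> = ennreal (\<Sum>n. C * \<rho> ^ n)"
      using \<rho> C(1) by (intro suminf_ennreal2 summable_mult summable_geometric) auto
    finally have "(\<Sum>n. ennreal (\<bar>det U\<bar> ^ n) * (\<integral>\<^sup>+x. indicator (cbox (- 1) 1) x * riesz \<gamma> ((((*v) V) ^^ n) x) \<partial>lborel)) < \<infinity>"
      by (simp add: le_less_trans[OF _ ennreal_less_top])
    then have "(\<integral>\<^sup>+u. indicator (cbox (- 1) 1) u * (\<integral>\<^sup>+\<omega>. riesz \<gamma> (X u \<omega>) \<partial>M) \<partial>lborel) < \<infinity>"
      using \<gamma>(1) assms(7) unfolding U_def[symmetric] V_def[symmetric]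
      by (intro expected_riesz_finite[OF assms(1) X _ affine inv U V]) auto
    then have "(\<integral>\<^sup>+\<omega>. \<integral>\<^sup>+z. riesz \<gamma> (X (fst z) \<omega> - X (snd z) \<omega>) \<partial>(N \<Otimes>\<^sub>M N) \<partial>M) \<noteq> \<infinity>"
      by (intro less_imp_neq le_less_trans[OF energy_le(1)[of \<gamma>]])
    then show ?thesis
      using nn_integral_noteq_infinite[OF energy_le(3)] by (simp add: less_top)
  qed
  show ?thesis
  proof (cases "s > 0")
    case True
    \<comment> \<open>A sequence is used because the exceptional null set depends on the exponent
      and only countably many may be united. The shift by 2 keeps \<open>\<gamma> 0\<close>
      positive.\<close>
    define \<gamma> where "\<gamma> n = s - s / real (n + 2)" for n
    have \<gamma>: "0 < \<gamma> n" "\<gamma> n < s" for n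
    proof -
      have "0 < s + s * real n"
        using True by (intro add_pos_nonneg) auto
      then show "0 < \<gamma> n" "\<gamma> n < s"
        using True by (simp_all add: \<gamma>_def field_simps)
    qed
    have "(\<lambda>n. s - s / real (n + 2)) \<longlonglongrightarrow> s - 0"
      by (intro tendsto_intros LIMSEQ_ignore_initial_segment[of "\<lambda>n. s / real n" 0 2] lim_const_over_n)
    then have lim: "\<gamma> \<longlonglongrightarrow> s"
      by (simp add: \<gamma>_def[abs_def])
    have "AE \<omega> in M. \<forall>n. (\<integral>\<^sup>+z. riesz (\<gamma> n) (X (fst z) \<omega> - X (snd z) \<omega>) \<partial>(N \<Otimes>\<^sub>M N)) < \<infinity>"
      unfolding AE_all_countable using energy \<gamma> by blast
    then show ?thesis
      using AE_space
    proof eventually_elim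
      case (elim \<omega>)
      have "ereal s \<le> hausdorff_dim ((\<lambda>t. X t \<omega>) ` space N)"
        using elim by (intro hausdorff_dim_ge_if_energies_finite[OF energy_le(2) X_\<omega> \<gamma>(1) lim]) auto
      then show ?case
        by (simp add: N_def space_restrict_space s_def)
    qed
  next
    case False
    \<comment> \<open>\<open>hausdorff_dim\<close> is an infimum over nonnegative exponents, so it
      dominates every \<open>s \<le> 0\<close>.\<close>
    then have "ereal s \<le> hausdorff_dim A" for A :: "(real^'m) set"
      unfolding hausdorff_dim_def by (intro Inf_greatest) auto
    then show ?thesis
      by (simp add: s_def)
  qed
qed

end
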